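(* Let $d\geq 1$ and $k\geq 3$ be integers. Then $$\delta(d,k)\leq kd-\left\lceil \frac{2d}{3}\right\rceil .$$
   Context: For integers $d\geq 1$, $k\geq 1$, a lattice $(d,k)$-polytope is the convex hull in $\mathbb{R}^d$ of a nonempty set of points of $\mathbb{Z}^d$ all of whose vertices belong to $\{0,1,\dots,k\}^d$ (it need not be full-dimensional). The graph of a polytope $P$ has as its nodes the vertices of $P$ and as its edges the pairs of vertices joined by a one-dimensional face of $P$. The diameter $\delta(P)$ of $P$ is the diameter of its graph (the largest graph distance between two vertices). The quantity $\delta(d,k)$ is the largest value of $\delta(P)$ over all lattice $(d,k)$-polytopes $P$. *)

theory Defs
  imports "HOL-Analysis.Analysis" "HOL-Library.Extended_Nat"
begin

(* The ambient space R^d is real ^ 'd with d = CARD('d); d >= 1 holds for every type 'd. *)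

definition integer_points :: "(real ^ 'd) set" where
  "integer_points = {x. \<forall>i. x $ i \<in> \<int>}"

definition polytope_vertices :: "(real ^ 'd) set \<Rightarrow> (real ^ 'd) set" where
  "polytope_vertices P = {v. v extreme_point_of P}"

definition lattice_polytope :: "nat \<Rightarrow> (real ^ 'd) set \<Rightarrow> bool" where
  "lattice_polytope k P \<longleftrightarrow>
     (\<exists>S. S \<noteq> {} \<and> finite S \<and> S \<subseteq> integer_points \<and> P = convex hull S) \<and>
     (\<forall>v\<in>polytope_vertices P. \<forall>i. v $ i \<in> real ` {0..k})"

(* edge_of: the segment is a face of P of affine dimension 1; in particular u and v differ. *)
definition polytope_edges :: "(real ^ 'd) set \<Rightarrow> (real ^ 'd) rel" where
  "polytope_edges P =
     {(u, v). u \<in> polytope_vertices P \<and> v \<in> polytope_vertices P \<and>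
              (closed_segment u v) edge_of P}"

(* Least length of a walk from u to v along the relation E (infinite if there is none);
   this is the graph distance when E is symmetric. *)
definition graph_distance :: "'a rel \<Rightarrow> 'a \<Rightarrow> 'a \<Rightarrow> enat" where
  "graph_distance E u v = (INF n\<in>{n. (u, v) \<in> E ^^ n}. enat n)"

definition polytope_diameter :: "(real ^ 'd) set \<Rightarrow> enat" where
  "polytope_diameter P =
     (SUP (u, v) \<in> polytope_vertices P \<times> polytope_vertices P.
        graph_distance (polytope_edges P) u v)"

(* delta(d,k), with d passed as TYPE('d). A supremum in enat of a nonempty set is attained
   whenever it is finite, so a finite upper bound on it is a bound on a genuine maximum. *)
definition max_diameter :: "'d::finite itself \<Rightarrow> nat \<Rightarrow> enat" where
  "max_diameter _ k = (SUP P \<in> {P :: (real ^ 'd) set. lattice_polytope k P}. polytope_diameter P)"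

end

theory Submission
  imports Defs
begin

text \<open>Let \<open>D\<^sub>n = k n - \<lceil>2 n / 3\<rceil>\<close>. Steering two vertices to a common face by a sum of \<open>m\<close> distances to
  facets of the cube, each edge of the paths lowering the sum by at least 1, bounds their distance by
  \<open>m k + D\<^bsub>n-m\<^esub>\<close>, and by less if the two vertices are not opposite in these \<open>m\<close> coordinates. As
  \<open>D\<^sub>n\<close> is at least \<open>D\<^bsub>n-1\<^esub> + k - 1\<close>, \<open>D\<^bsub>n-2\<^esub> + 2 k - 2\<close> and \<open>D\<^bsub>n-3\<^esub> + 3 k - 2\<close>, vertices \<open>u\<close>, \<open>v\<close>
  at distance more than \<open>D\<^sub>n\<close> satisfy \<open>u + v = (k, \<dots>, k)\<close>, and no path of \<open>t\<close> edges starting at them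
  gains more than \<open>t\<close> in one coordinate or more than \<open>t + 1\<close> in two or three coordinates together.
  Once \<open>t + 1\<close> is gained in two coordinates, every edge leading on to the corresponding corner of
  the square \<open>[0, k]\<^sup>2\<close> leaves the other coordinates fixed and gains exactly 1. Such unit steps can
  form a convex polygonal path only within a bounded distance of the corner, so, for \<open>k \<ge> 3\<close>, edges at \<open>u\<close> and \<open>v\<close>
  are parallel to the axes and \<open>u\<close> is a vertex of the cube, say the origin. But then \<open>e\<^sub>i\<close> and some
  \<open>2 e\<^sub>i + e\<^sub>j\<close> are vertices, which is \<open>t + 1\<close> with \<open>t = 2\<close>, and the next edge has the origin and
  \<open>k e\<^sub>i + k e\<^sub>j\<close> on different sides.\<close>

section \<open>Edges of polytopes\<close>

lemma polytope_verticesD: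
  assumes "v \<in> polytope_vertices P" shows "v extreme_point_of P" "v \<in> P"
  using assms by (auto simp: polytope_vertices_def extreme_point_of_def)

lemma polytope_vertices_face:
  "F face_of P \<Longrightarrow> polytope_vertices F = polytope_vertices P \<inter> F"
  by (auto simp: polytope_vertices_def extreme_point_of_face)

lemma polytope_edges_face:
  assumes "F face_of P" shows "polytope_edges F \<subseteq> polytope_edges P"
  using assms by (auto simp: polytope_edges_def edge_of_def polytope_vertices_face[OF assms]
      intro: face_of_trans)

lemma polytope_edges_sym: "(u, v) \<in> polytope_edges P \<Longrightarrow> (v, u) \<in> polytope_edges P"
  by (auto simp: polytope_edges_def closed_segment_commute)

lemma polytope_edgesD:
  assumes "(u, v) \<in> polytope_edges P"
  shows "u \<in> polytope_vertices P" "v \<in> polytope_vertices P" "u \<noteq> v" "closed_segment u v face_of P"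
  using assms by (auto simp: polytope_edges_def edge_of_def)

lemma polytope_hull_vertices:
  "polytope P \<Longrightarrow> P = convex hull (polytope_vertices P)"
  unfolding polytope_vertices_def
  by (intro Krein_Milman_Minkowski polytope_imp_compact polytope_imp_convex)

lemma polytope_vertices_nonempty:
  assumes "polytope P" "P \<noteq> {}" shows "polytope_vertices P \<noteq> {}"
  using polytope_hull_vertices[OF assms(1)] assms(2) by auto

lemma finite_polytope_vertices:
  assumes "polytope P" shows "finite (polytope_vertices P)"
  unfolding polytope_vertices_def
  by (intro finite_polyhedron_extreme_points polytope_imp_polyhedron assms)

text \<open>Otherwise \<open>y\<close> would be the mean of \<open>x\<close> and \<open>z\<close>
  with weights \<open>\<alpha>\<close> and \<open>\<beta>\<close>, hence inside an open segment of
  \<open>P\<close>. Unnormalised weights allow differences of coordinates to be used as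
  weights.\<close>

lemma vertex_not_between:
  assumes y: "y \<in> polytope_vertices P" and xz: "x \<in> P" "z \<in> P"
    and ab: "\<alpha> > 0" "\<beta> > 0" and eq: "\<And>l. \<alpha> * (y $ l - x $ l) = \<beta> * (z $ l - y $ l)"
  shows "x = y"
proof (rule ccontr)
  assume "x \<noteq> y"
  then obtain l where l: "x $ l \<noteq> y $ l" by (auto simp: vec_eq_iff)
  have "x \<noteq> z"
  proof
    assume "x = z"
    with eq[of l] have "(\<alpha> + \<beta>) * (y $ l - x $ l) = 0" by (simp add: algebra_simps)
    with ab l show False by auto
  qed
  define t where "t = \<beta> / (\<alpha> + \<beta>)"
  have t: "0 < t" "t < 1" using ab by (auto simp: t_def field_simps)
  have "y = (1 - t) *\<^sub>R x + t *\<^sub>R z"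
  proof (simp add: vec_eq_iff, intro allI)
    fix l
    have "(\<alpha> + \<beta>) * y $ l = \<alpha> * x $ l + \<beta> * z $ l" using eq[of l] by (simp add: algebra_simps)
    moreover have "(\<alpha> + \<beta>) * (1 - t) = \<alpha>" "(\<alpha> + \<beta>) * t = \<beta>" using ab by (auto simp: t_def field_simps)
    ultimately have "(\<alpha> + \<beta>) * y $ l = (\<alpha> + \<beta>) * ((1 - t) * x $ l + t * z $ l)"
      by (simp only: distrib_left mult.assoc[symmetric])
    then show "y $ l = (1 - t) * x $ l + t * z $ l" using ab by simp
  qed
  with t \<open>x \<noteq> z\<close> have "y \<in> open_segment x z" by (auto simp: in_segment)
  with y xz show False by (auto simp: polytope_vertices_def extreme_point_of_def)
qed

text \<open>Pass to facets through \<open>p\<close> until the face is a segment; its two ends form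
  the edge.\<close>

lemma polytope_vertex_has_neighbour:
  assumes "polytope F" "p \<in> polytope_vertices F" "F \<noteq> {p}"
  shows "\<exists>r. (p, r) \<in> polytope_edges F"
  using assms
proof (induction "nat (aff_dim F)" arbitrary: F rule: less_induct)
  case less
  have pF: "p \<in> F" using less.prems polytope_verticesD by blast
  have p_face: "{p} face_of F"
    using less.prems(2) by (simp add: face_of_singleton polytope_vertices_def)
  obtain x where x: "x \<in> F" "x \<noteq> p" using less.prems(3) pF by blast
  have "aff_dim {x, p} \<le> aff_dim F" using x pF by (intro aff_dim_subset) auto
  then have dim1: "aff_dim F \<ge> 1" using x by simp
  show ?case
  proof (cases "aff_dim F = 1")
    case True
    then have "collinear F" by (simp add: collinear_aff_dim)
    then obtain a b where ab: "F = closed_segment a b"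
      using compact_convex_collinear_segment[of F] pF less.prems(1)
      by (metis empty_iff polytope_imp_compact polytope_imp_convex)
    have V: "polytope_vertices F = {a, b}"
      using extreme_point_of_segment[of _ a b] by (auto simp: polytope_vertices_def ab)
    have "(a, b) \<in> polytope_edges F"
      using True less.prems(1) V unfolding polytope_edges_def edge_of_def
      by (simp add: ab[symmetric] face_of_refl polytope_imp_convex)
    from this polytope_edges_sym[OF this] show ?thesis using less.prems(2) unfolding V by auto
  next
    case False
    obtain G where G: "G facet_of F" "{p} \<subseteq> G"
      using face_of_polyhedron_subset_facet[OF polytope_imp_polyhedron p_face] less.prems by auto
    then have Gf: "G face_of F" and Gd: "aff_dim G = aff_dim F - 1"
      by (auto simp: facet_of_def)
    have "G \<noteq> {p}" using Gd False dim1 by auto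
    moreover have "p \<in> polytope_vertices G"
      using G less.prems(2) by (auto simp: polytope_vertices_face[OF Gf])
    moreover have "polytope G" using Gf less.prems(1) face_of_polytope_polytope by blast
    ultimately obtain r where "(p, r) \<in> polytope_edges G"
      using less.hyps[of G] Gd dim1 False by auto
    then show ?thesis using polytope_edges_face[OF Gf] by blast
  qed
qed

lemma polytope_le_if_vertices_le:
  assumes "polytope P" "\<And>r. r \<in> polytope_vertices P \<Longrightarrow> g \<bullet> r \<le> b" "x \<in> P"
  shows "g \<bullet> x \<le> b"
proof -
  have "convex hull (polytope_vertices P) \<subseteq> {x. g \<bullet> x \<le> b}"
    by (rule hull_minimal) (use assms(2) convex_halfspace_le in auto)
  then show ?thesis using polytope_hull_vertices[OF assms(1)] assms(3) by auto
qed

text \<open>Tilt a functional that exposes \<open>p\<close> towards \<open>c\<close> until \<open>p\<close> stops being its only maximiser: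
  on the face of maximisers, \<open>p\<close> is then the only minimiser of \<open>c\<close>.\<close>

lemma improving_edge:
  fixes c :: "real ^ 'd"
  assumes P: "polytope P" and p: "p \<in> polytope_vertices P" and x: "x \<in> P" "c \<bullet> x > c \<bullet> p"
  shows "\<exists>r. (p, r) \<in> polytope_edges P \<and> c \<bullet> r > c \<bullet> p"
proof -
  have pP: "p \<in> P" using p polytope_verticesD by blast
  have "{p} face_of P" using p by (simp add: face_of_singleton polytope_vertices_def)
  then have "{p} exposed_face_of P"
    using exposed_face_of_polyhedron[OF polytope_imp_polyhedron[OF P]] by blast
  then obtain h b where h: "P \<subseteq> {x. h \<bullet> x \<le> b}" "{p} = P \<inter> {x. h \<bullet> x = b}"
    unfolding exposed_face_of_def by blast
  have hlt: "h \<bullet> r < h \<bullet> p" if "r \<in> P" "r \<noteq> p" for r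
  proof -
    have "h \<bullet> p = b" "h \<bullet> r \<le> b" "h \<bullet> r \<noteq> b" using h that by auto
    then show ?thesis by simp
  qed
  define W where "W = {r \<in> polytope_vertices P. c \<bullet> r > c \<bullet> p}"
  have "finite W" using finite_polytope_vertices[OF P] by (simp add: W_def)
  have "W \<noteq> {}"
  proof
    assume "W = {}"
    then have "c \<bullet> x \<le> c \<bullet> p"
      by (intro polytope_le_if_vertices_le[OF P _ x(1)]) (auto simp: W_def not_less)
    then show False using x by simp
  qed
  \<comment> \<open>\<open>lam r\<close> is the multiple of \<open>c\<close> to be added to
    \<open>h\<close> for \<open>r\<close> to draw level with \<open>p\<close>.\<close>
  define lam where "lam r = (h \<bullet> p - h \<bullet> r) / (c \<bullet> r - c \<bullet> p)" for r
  define l0 where "l0 = Min (lam ` W)"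
  have "l0 \<in> lam ` W"
    unfolding l0_def by (rule Min_in) (use \<open>finite W\<close> \<open>W \<noteq> {}\<close> in auto)
  then obtain r0 where r0: "r0 \<in> W" "lam r0 = l0" by blast
  have l0_le: "l0 \<le> lam r" if "r \<in> W" for r
    using that \<open>finite W\<close> by (simp add: l0_def)
  have r0': "r0 \<in> P" "r0 \<noteq> p" "c \<bullet> r0 > c \<bullet> p" "r0 \<in> polytope_vertices P"
    using r0(1) polytope_verticesD(2) by (auto simp: W_def)
  have l0_pos: "l0 > 0" using hlt[OF r0'(1,2)] r0(2) r0'(3) by (auto simp: lam_def)
  define g where "g = h + l0 *\<^sub>R c"
  have g_eq: "g \<bullet> r = h \<bullet> r + l0 * (c \<bullet> r)" for r by (simp add: g_def inner_add_left)
  have "g \<bullet> r \<le> g \<bullet> p" if r: "r \<in> polytope_vertices P" for r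
  proof (cases "r \<in> W")
    case True
    then have "l0 * (c \<bullet> r - c \<bullet> p) \<le> h \<bullet> p - h \<bullet> r"
      using l0_le[OF True] by (simp add: lam_def W_def field_simps)
    then show ?thesis by (simp add: g_eq algebra_simps)
  next
    case False
    then have "l0 * (c \<bullet> r) \<le> l0 * (c \<bullet> p)" using r l0_pos by (simp add: W_def)
    moreover have "h \<bullet> r \<le> h \<bullet> p" using hlt[of r] polytope_verticesD[OF r] by fastforce
    ultimately show ?thesis by (simp add: g_eq)
  qed
  then have g_le: "g \<bullet> y \<le> g \<bullet> p" if "y \<in> P" for y
    using polytope_le_if_vertices_le[OF P _ that] by blast
  define F where "F = P \<inter> {y. g \<bullet> y = g \<bullet> p}"
  have F: "F face_of P"
    unfolding F_def by (rule face_of_Int_supporting_hyperplane_le)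
      (use P g_le polytope_imp_convex in auto)
  have "l0 * (c \<bullet> r0 - c \<bullet> p) = h \<bullet> p - h \<bullet> r0"
    using r0 r0'(3) by (auto simp: lam_def field_simps)
  then have "r0 \<in> F" using r0' by (simp add: F_def g_eq algebra_simps)
  have "p \<in> polytope_vertices F" using p pP unfolding polytope_vertices_face[OF F] by (simp add: F_def)
  moreover have "F \<noteq> {p}" using \<open>r0 \<in> F\<close> r0'(2) by blast
  ultimately obtain r where r: "(p, r) \<in> polytope_edges F"
    using polytope_vertex_has_neighbour[OF face_of_polytope_polytope[OF P F]] by blast
  then have "r \<in> F" "r \<noteq> p" using polytope_verticesD(2)[OF polytope_edgesD(2)[OF r]] polytope_edgesD(3)[OF r] by auto
  \<comment> \<open>The tilted functional is constant on \<open>F\<close>, so a drop in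
    \<open>h\<close> is paid for by a rise in \<open>c\<close>.\<close>
  then have "h \<bullet> r < h \<bullet> p" "g \<bullet> r = g \<bullet> p" using hlt by (auto simp: F_def)
  then have "l0 * (c \<bullet> r) > l0 * (c \<bullet> p)" by (simp add: g_eq)
  then have "c \<bullet> r > c \<bullet> p" using l0_pos by simp
  then show ?thesis using r polytope_edges_face[OF F] by blast
qed

lemma edge_exposed:
  assumes P: "polytope P" and e: "(p, r) \<in> polytope_edges P"
  obtains g where "g \<bullet> r = g \<bullet> p" "\<And>x. x \<in> P \<Longrightarrow> g \<bullet> x \<le> g \<bullet> p"
    "\<And>x. x \<in> P \<Longrightarrow> g \<bullet> x = g \<bullet> p \<Longrightarrow> x \<in> closed_segment p r"
proof -
  have "closed_segment p r exposed_face_of P"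
    using exposed_face_of_polyhedron[OF polytope_imp_polyhedron[OF P]] polytope_edgesD(4)[OF e] by blast
  then obtain h b where h: "P \<subseteq> {x. h \<bullet> x \<le> b}" "closed_segment p r = P \<inter> {x. h \<bullet> x = b}"
    unfolding exposed_face_of_def by blast
  have "p \<in> closed_segment p r" "r \<in> closed_segment p r" by auto
  then have "h \<bullet> p = b" "h \<bullet> r = b" unfolding h(2) by auto
  with that[of h] h show ?thesis by auto
qed

section \<open>Affine functions and walks that descend along them\<close>

definition affine_fun :: "(real ^ 'd \<Rightarrow> real) \<Rightarrow> bool" where
  "affine_fun \<phi> \<longleftrightarrow> (\<exists>a c. \<forall>x. \<phi> x = a + c \<bullet> x)"

lemma affine_fun_add [intro]:
  assumes "affine_fun \<phi>" "affine_fun \<psi>" shows "affine_fun (\<lambda>x. \<phi> x + \<psi> x)"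
proof -
  obtain a c b d where "\<forall>x. \<phi> x = a + c \<bullet> x" "\<forall>x. \<psi> x = b + d \<bullet> x"
    using assms unfolding affine_fun_def by blast
  then have "\<forall>x. \<phi> x + \<psi> x = (a + b) + (c + d) \<bullet> x" by (simp add: inner_add_left)
  then show ?thesis unfolding affine_fun_def by blast
qed

lemma decreasing_edge:
  assumes "polytope P" "p \<in> polytope_vertices P" "affine_fun \<phi>" "x \<in> P" "\<phi> x < \<phi> p"
  obtains r where "(p, r) \<in> polytope_edges P" "\<phi> r < \<phi> p"
proof -
  obtain a c where \<phi>: "\<And>x. \<phi> x = a + c \<bullet> x" using assms(3) unfolding affine_fun_def by blast
  have "(- c) \<bullet> x > (- c) \<bullet> p" using assms(5) by (simp add: \<phi>)
  from improving_edge[OF assms(1,2,4) this] that show ?thesis by (auto simp: \<phi>)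
qed

lemma affine_fun_attains_min:
  assumes "polytope P" "P \<noteq> {}" "affine_fun \<phi>"
  obtains m where "\<And>x. x \<in> P \<Longrightarrow> m \<le> \<phi> x" "{x \<in> P. \<phi> x = m} face_of P" "{x \<in> P. \<phi> x = m} \<noteq> {}"
proof -
  obtain a c where \<phi>: "\<And>x. \<phi> x = a + c \<bullet> x" using assms(3) unfolding affine_fun_def by blast
  have "continuous_on P (\<lambda>x. c \<bullet> x)" by (intro continuous_intros)
  then obtain y where y: "y \<in> P" "\<And>x. x \<in> P \<Longrightarrow> c \<bullet> y \<le> c \<bullet> x"
    using continuous_attains_inf[of P] assms polytope_imp_compact by blast
  have "(P \<inter> {x. c \<bullet> x = c \<bullet> y}) face_of P"
    by (rule face_of_Int_supporting_hyperplane_ge) (use assms(1) polytope_imp_convex y in auto)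
  moreover have "P \<inter> {x. c \<bullet> x = c \<bullet> y} = {x \<in> P. \<phi> x = \<phi> y}" by (auto simp: \<phi>)
  ultimately show ?thesis using that[of "\<phi> y"] y by (auto simp: \<phi>)
qed

text \<open>Real bounds let differences of coordinates count edges without truncated
  subtraction.\<close>

definition near :: "(real ^ 'd) set \<Rightarrow> real \<Rightarrow> real ^ 'd \<Rightarrow> real ^ 'd \<Rightarrow> bool" where
  "near P r u v \<longleftrightarrow> (\<exists>m. (u, v) \<in> polytope_edges P ^^ m \<and> real m \<le> r)"

definition diam_le :: "(real ^ 'd) set \<Rightarrow> real \<Rightarrow> bool" where
  "diam_le P r \<longleftrightarrow> (\<forall>u\<in>polytope_vertices P. \<forall>v\<in>polytope_vertices P. near P r u v)"

lemma near_refl: "0 \<le> r \<Longrightarrow> near P r u u"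
  unfolding near_def by (rule exI[of _ 0]) simp

lemma near_edge: "(u, v) \<in> polytope_edges P \<Longrightarrow> near P 1 u v"
  unfolding near_def by (rule exI[of _ 1]) simp

lemma near_mono: "near P r u v \<Longrightarrow> r \<le> s \<Longrightarrow> near P s u v"
  unfolding near_def by force

lemma near_trans: "near P r u v \<Longrightarrow> near P s v w \<Longrightarrow> near P (r + s) u w"
  unfolding near_def by (metis add_mono of_nat_add relpow_trans)

lemma near_sym:
  assumes "near P r u v" shows "near P r v u"
proof -
  have "(v, u) \<in> polytope_edges P ^^ m" if "(u, v) \<in> polytope_edges P ^^ m" for m
    using that
  proof (induction m arbitrary: v)
    case (Suc m)
    then obtain w where "(u, w) \<in> polytope_edges P ^^ m" "(w, v) \<in> polytope_edges P" by auto
    then show ?case using Suc.IH[of w] polytope_edges_sym[of w v] relpow_Suc_I2 by metis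
  qed simp
  then show ?thesis using assms unfolding near_def by blast
qed

lemma near_face:
  assumes "F face_of P" "near F r u v" shows "near P r u v"
proof -
  have "(u, v) \<in> polytope_edges F ^^ m \<Longrightarrow> (u, v) \<in> polytope_edges P ^^ m" for m
    using polytope_edges_face[OF assms(1)] by (induction m arbitrary: v) auto
  then show ?thesis using assms(2) unfolding near_def by blast
qed

lemma diam_le_mono: "diam_le P r \<Longrightarrow> r \<le> s \<Longrightarrow> diam_le P s"
  unfolding diam_le_def using near_mono by blast

text \<open>An edge that lowers an integer-valued function lowers it by at least 1, so the total
  drop bounds the number of edges.\<close>

lemma descend:
  assumes P: "polytope P" and \<phi>: "affine_fun \<phi>"
    and int: "\<And>v. v \<in> polytope_vertices P \<Longrightarrow> \<phi> v \<in> \<int>"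
    and p: "p \<in> polytope_vertices P" and m: "\<And>x. x \<in> P \<Longrightarrow> m \<le> \<phi> x" "{x \<in> P. \<phi> x = m} \<noteq> {}"
      "{x \<in> P. \<phi> x = m} face_of P"
  shows "\<exists>q\<in>polytope_vertices {x \<in> P. \<phi> x = m}. near P (\<phi> p - m) p q"
  using p
proof (induction "nat \<lfloor>\<phi> p - m\<rfloor>" arbitrary: p rule: less_induct)
  case less
  have pP: "p \<in> P" using less.prems polytope_verticesD by blast
  show ?case
  proof (cases "\<phi> p = m")
    case True
    then show ?thesis
      using less.prems pP polytope_vertices_face[OF m(3)] near_refl[of 0 P p] by auto
  next
    case False
    obtain y where "y \<in> P" "\<phi> y < \<phi> p" using m(1)[OF pP] m(2) False by fastforce
    then obtain r where r: "(p, r) \<in> polytope_edges P" "\<phi> r < \<phi> p"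
      using decreasing_edge[OF P less.prems \<phi>] by blast
    have rV: "r \<in> polytope_vertices P" using r polytope_edgesD by blast
    then have rP: "r \<in> P" using polytope_verticesD by blast
    have "\<phi> r + 1 \<le> \<phi> p"
      using int[OF rV] int[OF less.prems] r(2) by (auto elim!: Ints_cases)
    moreover have "nat \<lfloor>\<phi> r - m\<rfloor> < nat \<lfloor>\<phi> p - m\<rfloor>"
      using m(1)[OF rP] calculation by linarith
    then obtain q where q: "q \<in> polytope_vertices {x \<in> P. \<phi> x = m}" "near P (\<phi> r - m) r q"
      using less.hyps rV by blast
    have "near P (1 + (\<phi> r - m)) p q" using near_trans[OF near_edge[OF r(1)] q(2)] .
    ultimately have "near P (\<phi> p - m) p q" using near_mono by fastforce
    then show ?thesis using q(1) by blast
  qed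
qed

section \<open>Steering towards the facets of the cube\<close>

text \<open>Only vertices are restricted, so every nonempty face inherits the property.\<close>

definition cube_polytope :: "nat \<Rightarrow> (real ^ 'd) set \<Rightarrow> bool" where
  "cube_polytope k P \<longleftrightarrow>
     polytope P \<and> P \<noteq> {} \<and> (\<forall>v\<in>polytope_vertices P. \<forall>i. v $ i \<in> real ` {0..k})"

lemma cube_polytope_face:
  assumes "cube_polytope k P" "F face_of P" "F \<noteq> {}" shows "cube_polytope k F"
  using assms face_of_polytope_polytope unfolding cube_polytope_def
  by (auto simp: polytope_vertices_face[OF assms(2)])

text \<open>The distance of \<open>x\<close> from one of the two facets of the cube orthogonal to direction \<open>i\<close>,
  the Boolean choosing the facet.\<close>

definition gap :: "nat \<Rightarrow> bool \<Rightarrow> 'd \<Rightarrow> real ^ 'd \<Rightarrow> real" where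
  "gap k s i x = (if s then real k - x $ i else x $ i)"

lemma affine_fun_gap [intro]: "affine_fun (gap k s i)"
proof (cases s)
  case True
  then have "gap k s i x = real k + (- axis i 1) \<bullet> x" for x by (simp add: gap_def inner_axis')
  then show ?thesis unfolding affine_fun_def by blast
next
  case False
  then have "gap k s i x = 0 + axis i 1 \<bullet> x" for x by (simp add: gap_def inner_axis')
  then show ?thesis unfolding affine_fun_def by blast
qed

lemma gap_vertex:
  assumes "cube_polytope k P" "v \<in> polytope_vertices P"
  shows "gap k s i v \<in> \<int>" "0 \<le> gap k s i v" "gap k s i v \<le> real k"
proof -
  obtain n where "v $ i = real n" "n \<le> k" using assms unfolding cube_polytope_def by fastforce
  then show "gap k s i v \<in> \<int>" "0 \<le> gap k s i v" "gap k s i v \<le> real k"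
    by (auto simp: gap_def)
qed

lemma affine_fun_nonneg:
  assumes "polytope P" "affine_fun \<phi>" "\<And>v. v \<in> polytope_vertices P \<Longrightarrow> 0 \<le> \<phi> v" "x \<in> P"
  shows "0 \<le> \<phi> x"
proof -
  obtain a c where \<phi>: "\<And>x. \<phi> x = a + c \<bullet> x" using assms(2) unfolding affine_fun_def by blast
  have "(- c) \<bullet> x \<le> a"
    by (rule polytope_le_if_vertices_le[OF assms(1) _ assms(4)]) (use assms(3) in \<open>fastforce simp: \<phi>\<close>)
  then show ?thesis by (simp add: \<phi>)
qed

lemma gap_nonneg:
  assumes "cube_polytope k P" "x \<in> P" shows "0 \<le> gap k s i x"
  using assms gap_vertex affine_fun_nonneg[OF _ affine_fun_gap]
  by (metis cube_polytope_def)

lemma gap_le: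
  assumes "cube_polytope k P" "x \<in> P" shows "gap k s i x \<le> real k"
  using gap_nonneg[OF assms, of "\<not> s" i] by (auto simp: gap_def)

lemma gap_eq_iff: "gap k s i x = gap k s i y \<longleftrightarrow> x $ i = y $ i"
  by (auto simp: gap_def)

lemma gap_not: "gap k (\<not> s) i x = real k - gap k s i x"
  by (simp add: gap_def)

section \<open>Distances bounded by steering in one, two or three coordinates\<close>

lemma steer:
  assumes P: "cube_polytope k P" and \<phi>: "affine_fun \<phi>"
    and int: "\<And>v. v \<in> polytope_vertices P \<Longrightarrow> \<phi> v \<in> \<int>"
  obtains m F where "m \<in> \<int>" "F = {x \<in> P. \<phi> x = m}" "\<And>x. x \<in> P \<Longrightarrow> m \<le> \<phi> x"
    "F face_of P" "cube_polytope k F"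
    "\<And>p. p \<in> polytope_vertices P \<Longrightarrow> \<exists>p'\<in>polytope_vertices F. near P (\<phi> p - m) p p'"
proof -
  have pP: "polytope P" "P \<noteq> {}" using P by (auto simp: cube_polytope_def)
  obtain m where m: "\<And>x. x \<in> P \<Longrightarrow> m \<le> \<phi> x" "{x \<in> P. \<phi> x = m} face_of P" "{x \<in> P. \<phi> x = m} \<noteq> {}"
    using affine_fun_attains_min[OF pP \<phi>] by blast
  have F: "cube_polytope k {x \<in> P. \<phi> x = m}" using cube_polytope_face[OF P m(2,3)] .
  then obtain v where "v \<in> polytope_vertices {x \<in> P. \<phi> x = m}"
    using polytope_vertices_nonempty unfolding cube_polytope_def by blast
  then have "v \<in> polytope_vertices P" "\<phi> v = m" by (auto simp: polytope_vertices_face[OF m(2)])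
  then have "m \<in> \<int>" using int by auto
  then show ?thesis using that m F descend[OF pP(1) \<phi> int _ m(1,3,2)] by blast
qed

lemma near_via_face:
  assumes "F face_of P" "p' \<in> polytope_vertices F" "q' \<in> polytope_vertices F"
    "near P a p p'" "near P b q q'" "near F r p' q'" "a + b + r \<le> s"
  shows "near P s p q"
  using near_trans[OF near_trans[OF assms(4) near_face[OF assms(1,6)]] near_sym[OF assms(5)]] assms(7)
  by (auto intro: near_mono)

text \<open>Both vertices descend to the face of minimal gap, each paying its excess over
  \<open>m\<close>; coordinate \<open>i\<close> is constant there, so \<open>B\<close> bounds the
  rest.\<close>

lemma near_gap1:
  assumes P: "cube_polytope k P"
    and B: "\<And>F. F face_of P \<Longrightarrow> F \<noteq> {} \<Longrightarrow> (\<lambda>x. x $ i) constant_on F \<Longrightarrow> diam_le F B"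
  shows "\<exists>m\<in>\<int>. (\<forall>x\<in>P. m \<le> gap k s i x) \<and> (\<exists>x\<in>P. gap k s i x = m) \<and>
    (\<forall>p\<in>polytope_vertices P. \<forall>q\<in>polytope_vertices P.
       near P (gap k s i p + gap k s i q - 2 * m + B) p q)"
proof -
  obtain m F where F: "m \<in> \<int>" "F = {x \<in> P. gap k s i x = m}" "\<And>x. x \<in> P \<Longrightarrow> m \<le> gap k s i x"
    "F face_of P" "cube_polytope k F"
    "\<And>p. p \<in> polytope_vertices P \<Longrightarrow> \<exists>p'\<in>polytope_vertices F. near P (gap k s i p - m) p p'"
    using steer[OF P affine_fun_gap gap_vertex(1)[OF P], of s i thesis] by blast
  have "(\<lambda>x. x $ i) constant_on F"
    unfolding constant_on_def F(2) by (rule exI[of _ "if s then k - m else m"]) (auto simp: gap_def)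
  then have D: "diam_le F B" using B F by (auto simp: cube_polytope_def)
  have "near P (gap k s i p + gap k s i q - 2 * m + B) p q"
    if pq: "p \<in> polytope_vertices P" "q \<in> polytope_vertices P" for p q
  proof -
    obtain p' q' where p': "p' \<in> polytope_vertices F" "near P (gap k s i p - m) p p'"
      and q': "q' \<in> polytope_vertices F" "near P (gap k s i q - m) q q'" using F(6) pq by meson
    then have "near F B p' q'" using D by (simp add: diam_le_def)
    then show ?thesis by (rule near_via_face[OF F(4) p'(1) q'(1) p'(2) q'(2)]) simp
  qed
  moreover have "\<exists>x\<in>P. gap k s i x = m" using F by (auto simp: cube_polytope_def)
  ultimately show ?thesis using F(1,3) by blast
qed

text \<open>There are two routes, through the faces of least and of greatest gap. Their lengths add
  up to at most \<open>2 * (w + B)\<close>, so the shorter one suffices.\<close>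

lemma near_slab:
  assumes P: "cube_polytope k P"
    and B: "\<And>F. F face_of P \<Longrightarrow> F \<noteq> {} \<Longrightarrow> (\<lambda>x. x $ i) constant_on F \<Longrightarrow> diam_le F B"
    and w: "\<And>x. x \<in> P \<Longrightarrow> gap k s i x \<le> w"
  shows "diam_le P (w + B)"
  unfolding diam_le_def
proof (intro ballI)
  fix p q assume p: "p \<in> polytope_vertices P" and q: "q \<in> polytope_vertices P"
  have *: "\<exists>m. (\<exists>x\<in>P. gap k t i x = m) \<and> near P (gap k t i p + gap k t i q - 2 * m + B) p q" for t
    using near_gap1[OF P B, where s = t and i = i] p q by blast
  obtain m where m: "\<exists>x\<in>P. gap k s i x = m"
    and m': "near P (gap k s i p + gap k s i q - 2 * m + B) p q"
    using *[of s] by blast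
  obtain M where M: "\<exists>x\<in>P. gap k (\<not> s) i x = M"
    and M': "near P (gap k (\<not> s) i p + gap k (\<not> s) i q - 2 * M + B) p q"
    using *[of "\<not> s"] by blast
  have "0 \<le> m" using m gap_nonneg[OF P] by auto
  moreover have "real k - M \<le> w" using M w by (auto simp: gap_not)
  ultimately show "near P (w + B) p q"
    using near_mono[OF m', of "w + B"] near_mono[OF M', of "w + B"]
    by (simp add: gap_not) linarith
qed

text \<open>On the face where the sum of the gaps is minimal, each gap is at most \<open>m\<close>,
  and fixing coordinate \<open>i\<close> fixes coordinate \<open>j\<close>. Thus
  \<open>near_slab\<close> gives this face diameter at most \<open>m + B\<close>, and one of the two
  savings of \<open>m\<close> on the way there survives.\<close>

lemma near_gap2:
  assumes P: "cube_polytope k P"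
    and B: "\<And>F. F face_of P \<Longrightarrow> F \<noteq> {} \<Longrightarrow> (\<lambda>x. x $ i) constant_on F \<Longrightarrow>
              (\<lambda>x. x $ j) constant_on F \<Longrightarrow> diam_le F B"
  shows "\<exists>m\<in>\<int>. (\<exists>x\<in>P. gap k s i x + gap k s' j x = m) \<and>
    (\<forall>p\<in>polytope_vertices P. \<forall>q\<in>polytope_vertices P.
       near P (gap k s i p + gap k s i q + (gap k s' j p + gap k s' j q) - m + B) p q)"
proof -
  let ?\<phi> = "\<lambda>x. gap k s i x + gap k s' j x"
  have aff: "affine_fun ?\<phi>" by (intro affine_fun_add affine_fun_gap)
  have int: "?\<phi> v \<in> \<int>" if "v \<in> polytope_vertices P" for v
    using gap_vertex(1)[OF P that] by (intro Ints_add)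
  obtain m F where F: "m \<in> \<int>" "F = {x \<in> P. ?\<phi> x = m}" "\<And>x. x \<in> P \<Longrightarrow> m \<le> ?\<phi> x"
    "F face_of P" "cube_polytope k F"
    "\<And>p. p \<in> polytope_vertices P \<Longrightarrow> \<exists>p'\<in>polytope_vertices F. near P (?\<phi> p - m) p p'"
    using steer[OF P aff int] by blast
  have D: "diam_le F (m + B)"
  proof (rule near_slab[OF F(5)])
    fix G assume G: "G face_of F" "G \<noteq> {}" "(\<lambda>x. x $ i) constant_on G"
    have "G \<subseteq> F" using G face_of_imp_subset by blast
    obtain x0 where x0: "x0 \<in> G" using G by blast
    have "x $ j = x0 $ j" if "x \<in> G" for x
    proof -
      have "x $ i = x0 $ i" using that x0 G(3) unfolding constant_on_def by fastforce
      then have "gap k s i x = gap k s i x0" by (simp add: gap_eq_iff)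
      moreover have "?\<phi> x = m" "?\<phi> x0 = m" using that x0 \<open>G \<subseteq> F\<close> F(2) by blast+
      ultimately have "gap k s' j x = gap k s' j x0" by simp
      then show ?thesis by (simp add: gap_eq_iff)
    qed
    then have "(\<lambda>x. x $ j) constant_on G" unfolding constant_on_def by blast
    then show "diam_le G B" using B G F(4) face_of_trans by blast
  next
    fix x assume "x \<in> F"
    then show "gap k s i x \<le> m" using F(2) gap_nonneg[OF P, of x s' j] by auto
  qed
  have "near P (gap k s i p + gap k s i q + (gap k s' j p + gap k s' j q) - m + B) p q"
    if pq: "p \<in> polytope_vertices P" "q \<in> polytope_vertices P" for p q
  proof -
    obtain p' q' where p': "p' \<in> polytope_vertices F" "near P (?\<phi> p - m) p p'"
      and q': "q' \<in> polytope_vertices F" "near P (?\<phi> q - m) q q'" using F(6) pq by meson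
    then have "near F (m + B) p' q'" using D by (simp add: diam_le_def)
    then show ?thesis by (rule near_via_face[OF F(4) p'(1) q'(1) p'(2) q'(2)]) simp
  qed
  moreover have "\<exists>x\<in>P. ?\<phi> x = m" using F by (auto simp: cube_polytope_def)
  ultimately show ?thesis using F(1) by blast
qed

text \<open>Once coordinate \<open>i\<close> is fixed too, the gaps in \<open>j\<close> and
  \<open>l\<close> determine each other and lie between 0 and \<open>m\<close>: a slab of diameter
  at most \<open>m + B\<close>. Steering in \<open>i\<close> first costs at most another
  \<open>m\<close>.\<close>

lemma near_gap3_aux:
  assumes F: "cube_polytope k F"
    and B: "\<And>G. G face_of F \<Longrightarrow> G \<noteq> {} \<Longrightarrow> (\<lambda>x. x $ i) constant_on G \<Longrightarrow>
              (\<lambda>x. x $ j) constant_on G \<Longrightarrow> (\<lambda>x. x $ l) constant_on G \<Longrightarrow> diam_le G B"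
    and m: "\<And>x. x \<in> F \<Longrightarrow> gap k s i x + gap k s' j x + gap k s'' l x = m"
    and pq: "p \<in> polytope_vertices F" "q \<in> polytope_vertices F" "gap k s i p + gap k s i q \<le> m"
  shows "near F (2 * m + B) p q"
proof -
  have "diam_le G (m + B)" if G: "G face_of F" "G \<noteq> {}" "(\<lambda>x. x $ i) constant_on G" for G
  proof (rule near_slab[of k G j B s'])
    show "cube_polytope k G" using cube_polytope_face[OF F G(1,2)] .
    have GF: "G \<subseteq> F" using G face_of_imp_subset by blast
    show "gap k s' j x \<le> m" if "x \<in> G" for x
      using m[of x] gap_nonneg[OF F, of x s i] gap_nonneg[OF F, of x s'' l] that GF by auto
    fix H assume H: "H face_of G" "H \<noteq> {}" "(\<lambda>x. x $ j) constant_on H"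
    have HG: "H \<subseteq> G" using H face_of_imp_subset by blast
    then have Hi: "(\<lambda>x. x $ i) constant_on H" using G(3) constant_on_subset by blast
    obtain x0 where x0: "x0 \<in> H" using H by blast
    have "x $ l = x0 $ l" if "x \<in> H" for x
    proof -
      have "x $ i = x0 $ i" "x $ j = x0 $ j"
        using that x0 Hi H(3) unfolding constant_on_def by fastforce+
      then have "gap k s i x = gap k s i x0" "gap k s' j x = gap k s' j x0"
        by (simp_all add: gap_eq_iff)
      then have "gap k s'' l x = gap k s'' l x0"
        using m[of x] m[of x0] that x0 HG GF by (auto simp: subset_iff)
      then show ?thesis by (simp add: gap_eq_iff)
    qed
    then have "(\<lambda>x. x $ l) constant_on H" unfolding constant_on_def by blast
    then show "diam_le H B" using B[of H] H(2,3) Hi face_of_trans[OF H(1) G(1)] by blast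
  qed
  then obtain m1 where m1: "\<exists>x\<in>F. gap k s i x = m1"
    "near F (gap k s i p + gap k s i q - 2 * m1 + (m + B)) p q"
    using near_gap1[OF F, where i = i and B = "m + B" and s = s] pq by blast
  have "0 \<le> m1" using m1(1) gap_nonneg[OF F] by auto
  then show ?thesis using near_mono[OF m1(2)] pq(3) by simp
qed

lemma near_gap3:
  assumes P: "cube_polytope k P"
    and B: "\<And>F. F face_of P \<Longrightarrow> F \<noteq> {} \<Longrightarrow> (\<lambda>x. x $ i) constant_on F \<Longrightarrow>
              (\<lambda>x. x $ j) constant_on F \<Longrightarrow> (\<lambda>x. x $ l) constant_on F \<Longrightarrow> diam_le F B"
    and p: "p \<in> polytope_vertices P" and q: "q \<in> polytope_vertices P"
  shows "near P (gap k s i p + gap k s i q + (gap k s' j p + gap k s' j q) +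
           (gap k s'' l p + gap k s'' l q) + B) p q"
proof -
  let ?\<phi> = "\<lambda>x. gap k s i x + gap k s' j x + gap k s'' l x"
  have aff: "affine_fun ?\<phi>" by (intro affine_fun_add affine_fun_gap)
  have int: "?\<phi> v \<in> \<int>" if "v \<in> polytope_vertices P" for v
    using gap_vertex(1)[OF P that] by (intro Ints_add)
  obtain m F where F: "m \<in> \<int>" "F = {x \<in> P. ?\<phi> x = m}" "\<And>x. x \<in> P \<Longrightarrow> m \<le> ?\<phi> x"
    "F face_of P" "cube_polytope k F"
    "\<And>p. p \<in> polytope_vertices P \<Longrightarrow> \<exists>p'\<in>polytope_vertices F. near P (?\<phi> p - m) p p'"
    using steer[OF P aff int] by blast
  obtain p' q' where p': "p' \<in> polytope_vertices F" "near P (?\<phi> p - m) p p'"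
    and q': "q' \<in> polytope_vertices F" "near P (?\<phi> q - m) q q'" using F(6) p q by meson
  have m: "?\<phi> x = m" if "x \<in> F" for x using that F(2) by blast
  have BF: "diam_le G B" if "G face_of F" "G \<noteq> {}" "(\<lambda>x. x $ i) constant_on G"
    "(\<lambda>x. x $ j) constant_on G" "(\<lambda>x. x $ l) constant_on G" for G
    using B[OF face_of_trans[OF that(1) F(4)]] that by blast
  have mp: "?\<phi> p' = m" "?\<phi> q' = m" using m p'(1) q'(1) polytope_verticesD(2) by blast+
  have "0 \<le> m" using mp(1) gap_vertex(2)[OF F(5) p'(1)] by (metis add_nonneg_nonneg)
  \<comment> \<open>The three sums add up to \<open>2 * m\<close> with \<open>m\<close> nonnegative,
    so they cannot all exceed \<open>m\<close>.\<close>
  with mp consider "gap k s i p' + gap k s i q' \<le> m" | "gap k s' j p' + gap k s' j q' \<le> m"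
    | "gap k s'' l p' + gap k s'' l q' \<le> m" by linarith
  then have "near F (2 * m + B) p' q'"
  proof cases
    case 1
    then show ?thesis using near_gap3_aux[OF F(5) BF m p'(1) q'(1)] by blast
  next
    case 2
    have m': "gap k s' j x + gap k s i x + gap k s'' l x = m" if "x \<in> F" for x
      using m[OF that] by simp
    show ?thesis using near_gap3_aux[OF F(5) BF m' p'(1) q'(1) 2] by blast
  next
    case 3
    have m': "gap k s'' l x + gap k s i x + gap k s' j x = m" if "x \<in> F" for x
      using m[OF that] by simp
    show ?thesis using near_gap3_aux[OF F(5) BF m' p'(1) q'(1) 3] by blast
  qed
  then show ?thesis by (rule near_via_face[OF F(4) p'(1) q'(1) p'(2) q'(2)]) simp
qed

section \<open>Integrality, and convexity in the plane of two coordinates\<close>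

lemma Ints_less_imp_add1_le:
  fixes x y :: real
  assumes "x \<in> \<int>" "y \<in> \<int>" "x < y" shows "x + 1 \<le> y"
  using assms by (auto elim!: Ints_cases)

lemma Ints_abs_le_1_cases:
  fixes x :: real
  assumes "x \<in> \<int>" "- 1 \<le> x" "x \<le> 1" shows "x = - 1 \<or> x = 0 \<or> x = 1"
proof -
  obtain z where z: "x = of_int z" using assms(1) by (rule Ints_cases)
  then have "- 1 \<le> z" "z \<le> 1" using assms(2,3) by linarith+
  then have "z = - 1 \<or> z = 0 \<or> z = 1" by linarith
  then show ?thesis using z by auto
qed

text \<open>Replacing a coordinate by its gap only affects signs common to both sides. The case
  \<open>i = j\<close> is allowed and treats points that differ in one coordinate.\<close>

lemma vertex_not_between_gaps:
  assumes y: "y \<in> polytope_vertices P" and xz: "x \<in> P" "z \<in> P"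
    and ab: "\<alpha> > 0" "\<beta> > 0"
    and i: "\<alpha> * (gap k s i y - gap k s i x) = \<beta> * (gap k s i z - gap k s i y)"
    and j: "\<alpha> * (gap k s' j y - gap k s' j x) = \<beta> * (gap k s' j z - gap k s' j y)"
    and off: "\<And>l. l \<noteq> i \<Longrightarrow> l \<noteq> j \<Longrightarrow> x $ l = y $ l \<and> z $ l = y $ l"
  shows "x = y"
proof (rule vertex_not_between[OF y xz ab])
  have *: "\<alpha> * (y $ l - x $ l) = \<beta> * (z $ l - y $ l)"
    if "\<alpha> * (gap k t l y - gap k t l x) = \<beta> * (gap k t l z - gap k t l y)" for t l
    using that by (auto simp: gap_def algebra_simps split: if_splits)
  show "\<alpha> * (y $ l - x $ l) = \<beta> * (z $ l - y $ l)" for l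
    using *[OF i] *[OF j] off[of l] by (cases "l = i"; cases "l = j") auto
qed

text \<open>In the plane through \<open>p\<close> of directions \<open>i\<close> and
  \<open>j\<close>, the determinants put \<open>x\<close> and \<open>z\<close> strictly on different
  sides of the line through \<open>p\<close> and \<open>r\<close>. A functional exposing the edge
  forces both onto the same side.\<close>

lemma edge_side:
  fixes P :: "(real ^ 'd) set"
  assumes P: "polytope P" and e: "(p, r) \<in> polytope_edges P" and xz: "x \<in> P" "z \<in> P" and "i \<noteq> j"
    and off: "\<And>l. l \<noteq> i \<Longrightarrow> l \<noteq> j \<Longrightarrow> r $ l = p $ l \<and> x $ l = p $ l \<and> z $ l = p $ l"
    and y: "gap k s i r = gap k s i p + y1" "gap k s' j r = gap k s' j p + y2"
    and x: "gap k s i x = gap k s i p + x1" "gap k s' j x = gap k s' j p + x2"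
    and z: "gap k s i z = gap k s i p + z1" "gap k s' j z = gap k s' j p + z2"
    and det: "y1 * x2 - y2 * x1 > 0" "y1 * z2 - y2 * z1 < 0"
  shows False
proof -
  obtain g where g: "g \<bullet> r = g \<bullet> p" "\<And>x. x \<in> P \<Longrightarrow> g \<bullet> x \<le> g \<bullet> p"
    "\<And>x. x \<in> P \<Longrightarrow> g \<bullet> x = g \<bullet> p \<Longrightarrow> x \<in> closed_segment p r"
    using edge_exposed[OF P e] by blast
  define gi where "gi = (if s then - g $ i else g $ i)"
  define gj where "gj = (if s' then - g $ j else g $ j)"
  have lin: "g \<bullet> w - g \<bullet> p = gi * w1 + gj * w2"
    if "\<And>l. l \<noteq> i \<Longrightarrow> l \<noteq> j \<Longrightarrow> w $ l = p $ l"
      "gap k s i w = gap k s i p + w1" "gap k s' j w = gap k s' j p + w2" for w w1 w2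
  proof -
    have "g \<bullet> w - g \<bullet> p = (\<Sum>l\<in>UNIV. g $ l * (w $ l - p $ l))"
      by (simp add: inner_vec_def sum_subtractf algebra_simps)
    also have "\<dots> = (\<Sum>l\<in>{i, j}. g $ l * (w $ l - p $ l))"
      by (rule sum.mono_neutral_right) (use that in auto)
    also have "\<dots> = g $ i * (w $ i - p $ i) + g $ j * (w $ j - p $ j)" using \<open>i \<noteq> j\<close> by simp
    also have "g $ i * (w $ i - p $ i) = gi * w1"
      using that(2) by (auto simp: gap_def gi_def algebra_simps split: if_splits)
    also have "g $ j * (w $ j - p $ j) = gj * w2"
      using that(3) by (auto simp: gap_def gj_def algebra_simps split: if_splits)
    finally show ?thesis .
  qed
  have ltP: "gi * w1 + gj * w2 < 0"
    if w: "w \<in> P" "\<And>l. l \<noteq> i \<Longrightarrow> l \<noteq> j \<Longrightarrow> w $ l = p $ l"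
      "gap k s i w = gap k s i p + w1" "gap k s' j w = gap k s' j p + w2"
      "y1 * w2 - y2 * w1 \<noteq> 0" for w w1 w2
  proof (rule ccontr)
    assume "\<not> ?thesis"
    then have "g \<bullet> w = g \<bullet> p" using lin[OF w(2,3,4)] g(2)[OF w(1)] by linarith
    then have "w \<in> closed_segment p r" using g(3) w by blast
    then obtain t where "w = (1 - t) *\<^sub>R p + t *\<^sub>R r" by (auto simp: in_segment)
    then have "w $ l = (1 - t) * p $ l + t * r $ l" for l by simp
    then have "w $ l - p $ l = t * (r $ l - p $ l)" for l by (simp add: algebra_simps)
    then have "gap k c l w - gap k c l p = t * (gap k c l r - gap k c l p)" for c l
      by (simp add: gap_def algebra_simps)
    from this[of s i] this[of s' j] have "w1 = t * y1" "w2 = t * y2" using w(3,4) y by simp_all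
    then show False using w(5) by (simp add: algebra_simps)
  qed
  have X: "gi * x1 + gj * x2 < 0" by (rule ltP[OF xz(1) _ x]) (use off det in auto)
  have Z: "gi * z1 + gj * z2 < 0" by (rule ltP[OF xz(2) _ z]) (use off det in auto)
  have Y: "gi * y1 + gj * y2 = 0" using lin[OF _ y] off g(1) by simp
  define dx where "dx = y1 * x2 - y2 * x1"
  define dz where "dz = y1 * z2 - y2 * z1"
  let ?d = "(gi * x1 + gj * x2) * dz - (gi * z1 + gj * z2) * dx"
  \<comment> \<open>This combination is a multiple of the value at the edge direction, which is 0,
    whereas the signs of its two terms make it positive.\<close>
  have "?d = (gi * y1 + gj * y2) * (x1 * z2 - x2 * z1)" by (simp add: dx_def dz_def algebra_simps)
  then have "?d = 0" using Y by simp
  moreover have "(gi * x1 + gj * x2) * dz > 0" using X det(2) by (simp add: dz_def mult_neg_neg)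
  moreover have "(gi * z1 + gj * z2) * dx < 0" using Z det(1) by (simp add: dx_def mult_neg_pos)
  ultimately show False by simp
qed

section \<open>A pair of vertices that is too far apart\<close>

text \<open>A hypothetical counterexample to the bound \<open>D\<close>. All coordinates that vary
  on \<open>P\<close> lie in \<open>I\<close>, and \<open>B1\<close>, \<open>B2\<close>,
  \<open>B3\<close> bound the diameters of faces on which one, two or three coordinates of
  \<open>I\<close> are constant. The aim is to show that \<open>I\<close> is empty.\<close>

locale tight =
  fixes k :: nat and P :: "(real ^ 'd) set" and I :: "'d set" and u v :: "real ^ 'd"
    and D B1 B2 B3 :: real
  assumes cube: "cube_polytope k P" and k3: "3 \<le> k"
    and uV: "u \<in> polytope_vertices P" and vV: "v \<in> polytope_vertices P"
    and far: "\<not> near P D u v"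
    and D1: "B1 + real k - 1 \<le> D" and D2: "B2 + 2 * real k - 2 \<le> D"
    and D3: "B3 + 3 * real k - 2 \<le> D"
    and outside: "\<And>i x y. i \<notin> I \<Longrightarrow> x \<in> P \<Longrightarrow> y \<in> P \<Longrightarrow> x $ i = y $ i"
    and face1: "\<And>i F. i \<in> I \<Longrightarrow> F face_of P \<Longrightarrow> F \<noteq> {} \<Longrightarrow> (\<lambda>x. x $ i) constant_on F \<Longrightarrow> diam_le F B1"
    and face2: "\<And>i j F. i \<in> I \<Longrightarrow> j \<in> I \<Longrightarrow> i \<noteq> j \<Longrightarrow> F face_of P \<Longrightarrow> F \<noteq> {} \<Longrightarrow>
      (\<lambda>x. x $ i) constant_on F \<Longrightarrow> (\<lambda>x. x $ j) constant_on F \<Longrightarrow> diam_le F B2"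
    and face3: "\<And>i j l F. i \<in> I \<Longrightarrow> j \<in> I \<Longrightarrow> l \<in> I \<Longrightarrow> i \<noteq> j \<Longrightarrow> i \<noteq> l \<Longrightarrow> j \<noteq> l \<Longrightarrow>
      F face_of P \<Longrightarrow> F \<noteq> {} \<Longrightarrow> (\<lambda>x. x $ i) constant_on F \<Longrightarrow> (\<lambda>x. x $ j) constant_on F \<Longrightarrow>
      (\<lambda>x. x $ l) constant_on F \<Longrightarrow> diam_le F B3"
begin

lemma swapped: "tight k P I v u D B1 B2 B3"
  using cube k3 uV vV far D1 D2 D3 outside face1 face2 face3 near_sym[of P D v u]
  unfolding tight_def by blast

lemma polytope_P: "polytope P" using cube by (simp add: cube_polytope_def)

section \<open>How far walks from \<open>u\<close> and \<open>v\<close> can advance\<close>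

lemma far_detour:
  assumes "near P (real a) u p" "near P (real b) v q" "near P r p q"
  shows "D < real a + real b + r"
proof (rule ccontr)
  assume "\<not> ?thesis"
  then have "near P D u v"
    using near_mono[OF near_trans[OF near_trans[OF assms(1,3)] near_sym[OF assms(2)]]] by simp
  with far show False by blast
qed

lemma gap_less_imp:
  assumes "p \<in> polytope_vertices P" "q \<in> polytope_vertices P" "gap k s i p < gap k s i q"
  shows "gap k s i p + 1 \<le> gap k s i q"
  using Ints_less_imp_add1_le gap_vertex(1)[OF cube] assms by blast

text \<open>Steering in coordinate \<open>i\<close> costs the two gaps plus \<open>B1\<close>; by
  \<open>D1\<close> any smaller total would join \<open>u\<close> to \<open>v\<close> within
  \<open>D\<close>. Integrality absorbs the 1 in \<open>D1\<close>.\<close>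

lemma reach1:
  assumes p: "near P (real a) u p" "p \<in> polytope_vertices P"
    and q: "near P (real b) v q" "q \<in> polytope_vertices P" and i: "i \<in> I"
  shows "real k \<le> gap k s i p + gap k s i q + real a + real b"
proof -
  obtain m where m: "\<exists>x\<in>P. gap k s i x = m"
    "near P (gap k s i p + gap k s i q - 2 * m + B1) p q"
    using near_gap1[OF cube face1[OF i], where s = s] p(2) q(2) by blast
  have "0 \<le> m" using m(1) gap_nonneg[OF cube] by auto
  then have "real k < gap k s i p + gap k s i q + real a + real b + 1"
    using far_detour[OF p(1) q(1) m(2)] D1 by linarith
  moreover have "gap k s i p + gap k s i q + real a + real b + 1 \<in> \<int>"
    using gap_vertex(1)[OF cube] p(2) q(2) by simp
  ultimately have "real k + 1 \<le> gap k s i p + gap k s i q + real a + real b + 1"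
    by (intro Ints_less_imp_add1_le) auto
  then show ?thesis by simp
qed

text \<open>As in \<open>reach1\<close>, but \<open>D2\<close> gives away 2 and integrality recovers
  only 1, which leaves the final \<open>+ 1\<close>. The minimum \<open>m\<close> is kept because it
  must vanish once this slack is used up.\<close>

lemma reach2:
  assumes p: "near P (real a) u p" "p \<in> polytope_vertices P"
    and q: "near P (real b) v q" "q \<in> polytope_vertices P" and ij: "i \<in> I" "j \<in> I" "i \<noteq> j"
  obtains m where "0 \<le> m" "\<exists>x\<in>P. gap k s i x + gap k s' j x = m"
    "2 * real k + m \<le> gap k s i p + gap k s i q + (gap k s' j p + gap k s' j q) + real a + real b + 1"
proof -
  obtain m where mZ: "m \<in> \<int>" and m: "\<exists>x\<in>P. gap k s i x + gap k s' j x = m"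
    "near P (gap k s i p + gap k s i q + (gap k s' j p + gap k s' j q) - m + B2) p q"
    using near_gap2[OF cube face2[OF ij], where s = s and s' = s'] p(2) q(2) by blast
  have "0 \<le> m" using m(1) gap_nonneg[OF cube] by (metis add_nonneg_nonneg)
  have "2 * real k + m < gap k s i p + gap k s i q + (gap k s' j p + gap k s' j q) + real a + real b + 2"
    using far_detour[OF p(1) q(1) m(2)] D2 by linarith
  moreover have "gap k s i p + gap k s i q + (gap k s' j p + gap k s' j q) + real a + real b + 2 \<in> \<int>"
    using gap_vertex(1)[OF cube] p(2) q(2) by simp
  moreover have "2 * real k + m \<in> \<int>" using mZ by simp
  ultimately have "2 * real k + m + 1 \<le>
      gap k s i p + gap k s i q + (gap k s' j p + gap k s' j q) + real a + real b + 2"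
    using Ints_less_imp_add1_le by blast
  then show ?thesis using that[OF \<open>0 \<le> m\<close> m(1)] by simp
qed

text \<open>Since \<open>D3\<close> also gives away only 2, the slack for three coordinates is the
  same as for two: a pair that uses it leaves nothing for a third coordinate.\<close>

lemma reach3:
  assumes p: "near P (real a) u p" "p \<in> polytope_vertices P"
    and q: "near P (real b) v q" "q \<in> polytope_vertices P"
    and ijl: "i \<in> I" "j \<in> I" "l \<in> I" "i \<noteq> j" "i \<noteq> l" "j \<noteq> l"
  shows "3 * real k \<le> gap k s i p + gap k s i q + (gap k s' j p + gap k s' j q) +
           (gap k s'' l p + gap k s'' l q) + real a + real b + 1" (is "_ \<le> ?r + 1")
proof -
  have "near P (gap k s i p + gap k s i q + (gap k s' j p + gap k s' j q) +
           (gap k s'' l p + gap k s'' l q) + B3) p q"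
    using near_gap3[OF cube face3[OF ijl] p(2) q(2)] by blast
  from far_detour[OF p(1) q(1) this] D3 have "3 * real k < ?r + 2" by linarith
  moreover have "?r + 2 \<in> \<int>" using gap_vertex(1)[OF cube] p(2) q(2) by simp
  ultimately have "3 * real k + 1 \<le> ?r + 2" by (intro Ints_less_imp_add1_le) auto
  then show ?thesis by simp
qed

lemma near_u: "near P (real 0) u u" and near_v: "near P (real 0) v v"
  by (simp_all add: near_refl)

text \<open>By \<open>reach1\<close> the sum is at least \<open>k\<close> for either facet, and the
  two sums add up to \<open>2 * k\<close>.\<close>

lemma gap_u_v:
  assumes "i \<in> I" shows "gap k s i u + gap k s i v = real k"
  using reach1[OF near_u uV near_v vV assms, of s] reach1[OF near_u uV near_v vV assms, of "\<not> s"]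
  by (simp add: gap_not)

lemma reach_u:
  assumes "near P (real a) u p" "p \<in> polytope_vertices P" "i \<in> I"
  shows "gap k s i u - real a \<le> gap k s i p"
  using reach1[OF assms(1,2) near_v vV assms(3), of s] gap_u_v[OF assms(3), of s] by simp

text \<open>A positive minimal gap \<open>m\<close> would shorten the route of
  \<open>near_gap1\<close> by \<open>2 * m\<close>, which is at least 2.\<close>

lemma touches_facet:
  assumes i: "i \<in> I" shows "\<exists>x\<in>P. gap k s i x = 0"
proof -
  obtain m where m: "m \<in> \<int>" "\<exists>x\<in>P. gap k s i x = m"
    "near P (gap k s i u + gap k s i v - 2 * m + B1) u v"
    using near_gap1[OF cube face1[OF i], where s = s] uV vV by blast
  have "0 \<le> m" using m(2) gap_nonneg[OF cube] by auto
  moreover have "2 * m < 1"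
    using far_detour[OF near_u near_v m(3)] D1 gap_u_v[OF i, of s] by simp
  ultimately have "m = 0" using m(1) by (auto elim!: Ints_cases)
  then show ?thesis using m(2) by simp
qed

lemma gap_decreasing_edge:
  assumes "i \<in> I" "p \<in> polytope_vertices P" "0 < gap k s i p"
  obtains r where "(p, r) \<in> polytope_edges P" "gap k s i r < gap k s i p"
proof -
  obtain x where "x \<in> P" "gap k s i x < gap k s i p"
    using touches_facet[OF assms(1), of s] assms(3) by auto
  then show ?thesis using decreasing_edge[OF polytope_P assms(2) affine_fun_gap] that by blast
qed

lemma near_u_edge:
  assumes "near P (real a) u p" "(p, r) \<in> polytope_edges P" shows "near P (real (Suc a)) u r"
  using near_trans[OF assms(1) near_edge[OF assms(2)]] by (simp add: add.commute)

text \<open>Having moved from \<open>u\<close> to \<open>p\<close> and from \<open>v\<close> to \<open>q\<close>, one is a step ahead of the trivial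
  estimate for reaching the corner that \<open>s\<close> and \<open>s'\<close> select in the coordinates \<open>i\<close> and \<open>j\<close>.\<close>

definition ahead :: "bool \<Rightarrow> 'd \<Rightarrow> bool \<Rightarrow> 'd \<Rightarrow> nat \<Rightarrow> real ^ 'd \<Rightarrow> nat \<Rightarrow> real ^ 'd \<Rightarrow> bool" where
  "ahead s i s' j a p b q \<longleftrightarrow>
     i \<in> I \<and> j \<in> I \<and> i \<noteq> j \<and> near P (real a) u p \<and> p \<in> polytope_vertices P \<and>
     near P (real b) v q \<and> q \<in> polytope_vertices P \<and>
     gap k s i p + gap k s i q + (gap k s' j p + gap k s' j q) + real a + real b + 1 = 2 * real k"

lemma aheadD:
  assumes "ahead s i s' j a p b q"
  shows "i \<in> I" "j \<in> I" "i \<noteq> j" "near P (real a) u p" "p \<in> polytope_vertices P"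
    "near P (real b) v q" "q \<in> polytope_vertices P" "p \<in> P"
    "gap k s i p + gap k s i q + (gap k s' j p + gap k s' j q) + real a + real b + 1 = 2 * real k"
  using assms polytope_verticesD(2) unfolding ahead_def by auto

lemma ahead_commute: "ahead s i s' j a p b q \<Longrightarrow> ahead s' j s i a p b q"
  unfolding ahead_def by auto

text \<open>The pair \<open>i\<close>, \<open>j\<close> has used the slack in \<open>reach3\<close>,
  so the gaps in \<open>l\<close> sum to at least \<open>k\<close> for both facets, hence to exactly
  \<open>k\<close>.\<close>

lemma ahead_others:
  assumes A: "ahead s i s' j a p b q" and l: "l \<noteq> i" "l \<noteq> j"
  shows "p $ l + q $ l = u $ l + v $ l"
proof (cases "l \<in> I")
  case True
  note A' = aheadD[OF A]
  have "real k \<le> gap k t l p + gap k t l q" for t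
    using reach3[OF A'(4-7) A'(1,2) True A'(3) l[symmetric], of s s' t] A'(9) by simp
  from this[of True] this[of False] have "p $ l + q $ l = k" by (simp add: gap_def)
  moreover have "u $ l + v $ l = k" using gap_u_v[OF True, of False] by (simp add: gap_def)
  ultimately show ?thesis by simp
next
  case False
  then have "p $ l = u $ l" "q $ l = v $ l"
    using outside aheadD(5,7)[OF A] uV vV polytope_verticesD(2) by blast+
  then show ?thesis by simp
qed

text \<open>A drop by more than 1 would violate \<open>reach2\<close>. So \<open>r\<close> is ahead
  as well, and \<open>ahead_others\<close> holds for \<open>p\<close> and for \<open>r\<close> with
  the same \<open>q\<close>, which fixes the remaining coordinates.\<close>

lemma ahead_edge:
  assumes A: "ahead s i s' j a p b q" and e: "(p, r) \<in> polytope_edges P"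
    and less: "gap k s i r + gap k s' j r < gap k s i p + gap k s' j p"
  shows "gap k s i r + gap k s' j r = gap k s i p + gap k s' j p - 1"
    and "ahead s i s' j (Suc a) r b q" and "l \<noteq> i \<Longrightarrow> l \<noteq> j \<Longrightarrow> r $ l = p $ l"
proof -
  note A' = aheadD[OF A]
  have rV: "r \<in> polytope_vertices P" using polytope_edgesD(2)[OF e] .
  have nr: "near P (real (Suc a)) u r" using near_u_edge[OF A'(4) e] .
  obtain m where "0 \<le> m" "2 * real k + m \<le> gap k s i r + gap k s i q + (gap k s' j r + gap k s' j q)
      + real (Suc a) + real b + 1"
    using reach2[OF nr rV A'(6,7) A'(1-3)] by metis
  moreover have "gap k s i r + gap k s' j r + 1 \<le> gap k s i p + gap k s' j p"
    using less gap_vertex(1)[OF cube] rV A'(5) by (intro Ints_less_imp_add1_le) auto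
  ultimately show eq: "gap k s i r + gap k s' j r = gap k s i p + gap k s' j p - 1"
    using A'(9) by simp
  then show A2: "ahead s i s' j (Suc a) r b q"
    using A' rV nr by (auto simp: ahead_def)
  show "r $ l = p $ l" if "l \<noteq> i" "l \<noteq> j"
    using ahead_others[OF A that] ahead_others[OF A2 that] by simp
qed

text \<open>The slack in \<open>reach2\<close> is used, so the sum of the gaps reaches 0 on
  \<open>P\<close> and can still be lowered at \<open>p\<close>.\<close>

lemma ahead_obtain_edge:
  assumes A: "ahead s i s' j a p b q" and pos: "0 < gap k s i p + gap k s' j p"
  obtains r where "(p, r) \<in> polytope_edges P" "gap k s i r + gap k s' j r < gap k s i p + gap k s' j p"
proof -
  note A' = aheadD[OF A]
  obtain m where "0 \<le> m" "\<exists>x\<in>P. gap k s i x + gap k s' j x = m"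
    "2 * real k + m \<le> gap k s i p + gap k s i q + (gap k s' j p + gap k s' j q) + real a + real b + 1"
    using reach2[OF A'(4-7) A'(1-3)] by metis
  then obtain x where "x \<in> P" "gap k s i x + gap k s' j x < gap k s i p + gap k s' j p"
    using A'(9) pos by auto
  then show ?thesis
    using decreasing_edge[OF polytope_P A'(5) affine_fun_add[OF affine_fun_gap affine_fun_gap]] that
    by blast
qed

text \<open>Follow edges as in \<open>ahead_edge\<close> until both gaps vanish. The corner is the
  far point in the convexity arguments below.\<close>

lemma ahead_corner:
  assumes "ahead s i s' j a p b q"
  shows "\<exists>z\<in>P. gap k s i z = 0 \<and> gap k s' j z = 0 \<and> (\<forall>l. l \<noteq> i \<longrightarrow> l \<noteq> j \<longrightarrow> z $ l = p $ l)"
  using assms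
proof (induction "nat \<lfloor>gap k s i p + gap k s' j p\<rfloor>" arbitrary: a p rule: less_induct)
  case less
  note A' = aheadD[OF less.prems]
  have nonneg: "0 \<le> gap k s i p" "0 \<le> gap k s' j p" using gap_nonneg[OF cube A'(8)] by auto
  show ?case
  proof (cases "0 < gap k s i p + gap k s' j p")
    case False
    then show ?thesis using nonneg A'(8) by (intro bexI[of _ p]) auto
  next
    case True
    obtain r where r: "(p, r) \<in> polytope_edges P"
      "gap k s i r + gap k s' j r < gap k s i p + gap k s' j p"
      using ahead_obtain_edge[OF less.prems True] by blast
    note E = ahead_edge[OF less.prems r]
    have "nat \<lfloor>gap k s i r + gap k s' j r\<rfloor> < nat \<lfloor>gap k s i p + gap k s' j p\<rfloor>"
      using E(1) True gap_nonneg[OF cube aheadD(8)[OF E(2)], of s i]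
        gap_nonneg[OF cube aheadD(8)[OF E(2)], of s' j] by linarith
    from less.hyps[OF this E(2)] E(3) show ?thesis by metis
  qed
qed

text \<open>The edge runs parallel to axis \<open>j\<close>, so \<open>x\<close> and the corner
  cannot lie strictly on different sides of it; this forces the gap in \<open>i\<close> to be 0. The
  edge then points straight at the corner and must end there, as \<open>r\<close> cannot lie between
  \<open>p\<close> and the corner.\<close>

lemma ahead_straight:
  assumes A: "ahead s i s' j a p b q" and e: "(p, r) \<in> polytope_edges P"
    and r: "gap k s i r = gap k s i p" "gap k s' j r = gap k s' j p - 1"
    and x: "x \<in> P" "gap k s i p < gap k s i x" "\<And>l. l \<noteq> i \<Longrightarrow> l \<noteq> j \<Longrightarrow> x $ l = p $ l"
  shows "gap k s i p = 0" "gap k s' j p = 1"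
proof -
  have rP: "r \<in> polytope_vertices P" "r \<in> P"
    using polytope_edgesD(2)[OF e] polytope_verticesD(2) by blast+
  have off: "r $ l = p $ l" if "l \<noteq> i" "l \<noteq> j" for l
    using ahead_edge(3)[OF A e _ that] r by simp
  obtain z where z: "z \<in> P" "gap k s i z = 0" "gap k s' j z = 0"
    "\<And>l. l \<noteq> i \<Longrightarrow> l \<noteq> j \<Longrightarrow> z $ l = p $ l" using ahead_corner[OF A] by blast
  have "\<not> 0 < gap k s i p"
  proof
    assume "0 < gap k s i p"
    then show False
      using x z off r
      by (intro edge_side[OF polytope_P e x(1) z(1) aheadD(3)[OF A], of k s 0 s' "-1"
            "gap k s i x - gap k s i p" "gap k s' j x - gap k s' j p" "- gap k s i p" "- gap k s' j p"])
        auto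
  qed
  then show i0: "gap k s i p = 0" using gap_nonneg[OF cube aheadD(8)[OF A], of s i] by simp
  have "\<not> 1 < gap k s' j p"
  proof
    assume "1 < gap k s' j p"
    moreover have "gap k s' j p = gap k s' j r + 1" using r(2) by simp
    ultimately have "p = r"
      using r(1) i0 z off
      by (intro vertex_not_between_gaps[OF rP(1) aheadD(8)[OF A] z(1), of "gap k s' j r" 1 k s i s' j])
        auto
    then show False using polytope_edgesD(3)[OF e] by simp
  qed
  then show "gap k s' j p = 1" using r(2) gap_nonneg[OF cube rP(2), of s' j] by simp
qed


lemma axis_edge_bound:
  assumes A: "ahead s i s' j 0 u b q" and e: "(u, r) \<in> polytope_edges P"
    and r: "gap k s i r = gap k s i u - 1" "gap k s' j r = gap k s' j u"
  shows "gap k s i u + gap k s' j u \<le> 2"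
proof (cases "0 < gap k s i r + gap k s' j r")
  case False
  then show ?thesis using r by simp
next
  case True
  have A1: "ahead s i s' j 1 r b q" using ahead_edge(2)[OF A e] r by simp
  note A1' = aheadD[OF A1]
  have ur: "u \<noteq> r" using polytope_edgesD(3)[OF e] .
  have uP: "u \<in> P" using aheadD(8)[OF A] .
  have off1: "r $ l = u $ l" if "l \<noteq> i" "l \<noteq> j" for l
    using ahead_edge(3)[OF A e _ that] r by simp
  obtain w where w: "(r, w) \<in> polytope_edges P"
    "gap k s i w + gap k s' j w < gap k s i r + gap k s' j r"
    using ahead_obtain_edge[OF A1 True] by blast
  note W = ahead_edge[OF A1 w]
  have A2: "ahead s i s' j 2 w b q" using W(2) by (simp add: numeral_2_eq_2)
  note A2' = aheadD[OF A2]
  have off: "w $ l = r $ l \<and> u $ l = r $ l" if "l \<noteq> i" "l \<noteq> j" for l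
    using W(3)[OF that] off1[OF that] by simp
  obtain z where z: "z \<in> P" "gap k s i z = 0" "gap k s' j z = 0"
    "\<And>l. l \<noteq> i \<Longrightarrow> l \<noteq> j \<Longrightarrow> z $ l = r $ l" using ahead_corner[OF A1] by blast
  \<comment> \<open>The second edge has direction \<open>(\<alpha>, - 1 - \<alpha>)\<close> in gap
    coordinates; as \<open>w\<close> is two edges from \<open>u\<close>, \<open>\<alpha>\<close> is
    -1, 0 or 1.\<close>
  define \<alpha> where "\<alpha> = gap k s i w - gap k s i r"
  have wi: "gap k s i w = gap k s i r + \<alpha>" and wj: "gap k s' j w = gap k s' j r + (- 1 - \<alpha>)"
    using W(1) by (auto simp: \<alpha>_def)
  have "\<alpha> \<in> \<int>" using gap_vertex(1)[OF cube] A1'(5) A2'(5) by (simp add: \<alpha>_def)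
  moreover have "- 1 \<le> \<alpha>"
    using reach_u[OF A2'(4,5,1), of s] r wi by simp
  moreover have "\<alpha> \<le> 1"
    using reach_u[OF A2'(4,5,2), of s'] r wj by simp
  ultimately consider "\<alpha> = - 1" | "\<alpha> = 0" | "\<alpha> = 1" using Ints_abs_le_1_cases by blast
  then show ?thesis
  proof cases
    case 1
    then have "u = r"
      using r wi wj off
      by (intro vertex_not_between_gaps[OF A1'(5) uP A2'(8), of 1 1 k s i s' j]) auto
    with ur show ?thesis by simp
  next
    case 2
    then show ?thesis
      using ahead_straight[OF A1 w(1) _ _ uP] wi wj r off by simp
  next
    case 3
    have "0 \<le> gap k s i r" "2 \<le> gap k s' j r"
      using gap_nonneg[OF cube A1'(8), of s i] gap_nonneg[OF cube A2'(8), of s' j] wj 3 by auto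
    \<comment> \<open>With direction \<open>(1, - 2)\<close>, the edge would separate
      \<open>u\<close> from the corner.\<close>
    then have False
      using 3 r wi wj off z
      by (intro edge_side[OF polytope_P w(1) uP z(1) A1'(3), of k s 1 s' "- 2" 1 0
            "- gap k s i r" "- gap k s' j r"]) auto
    then show ?thesis ..
  qed
qed

text \<open>A single edge at \<open>u\<close> gains at most 1 in each coordinate, so a total gain of
  1 leaves only the two axis directions.\<close>

lemma ahead_start_bound:
  assumes A: "ahead s i s' j 0 u b q"
  shows "gap k s i u + gap k s' j u \<le> 2"
proof (cases "0 < gap k s i u + gap k s' j u")
  case False
  then show ?thesis by simp
next
  case True
  obtain r where r: "(u, r) \<in> polytope_edges P"
    "gap k s i r + gap k s' j r < gap k s i u + gap k s' j u"
    using ahead_obtain_edge[OF A True] by blast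
  note R = ahead_edge[OF A r]
  have A1: "ahead s i s' j 1 r b q" using R(2) by simp
  note A1' = aheadD[OF A1]
  define \<alpha> where "\<alpha> = gap k s i r - gap k s i u"
  have ri: "gap k s i r = gap k s i u + \<alpha>" and rj: "gap k s' j r = gap k s' j u + (- 1 - \<alpha>)"
    using R(1) by (auto simp: \<alpha>_def)
  have "\<alpha> \<in> \<int>" using gap_vertex(1)[OF cube] A1'(5) uV by (simp add: \<alpha>_def)
  moreover have "- 1 \<le> \<alpha>" using reach_u[OF A1'(4,5,1), of s] ri by simp
  moreover have "\<alpha> \<le> 0" using reach_u[OF A1'(4,5,2), of s'] rj by simp
  ultimately consider "\<alpha> = - 1" | "\<alpha> = 0" using Ints_abs_le_1_cases[of \<alpha>] by auto
  then show ?thesis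
  proof cases
    case 1
    then show ?thesis using axis_edge_bound[OF A r(1)] ri rj by simp
  next
    case 2
    then show ?thesis using axis_edge_bound[OF ahead_commute[OF A] r(1)] ri rj by simp
  qed
qed

section \<open>Edges at \<open>u\<close> are parallel to the axes\<close>

lemma diagonal_edge_ahead:
  assumes e: "(u, r) \<in> polytope_edges P" and ij: "i \<in> I" "j \<in> I" "i \<noteq> j"
    and r: "gap k s i r = gap k s i u - 1" "gap k s' j r = gap k s' j u - 1"
  shows "ahead s i s' j 1 r 0 v"
  using assms near_edge[OF e] near_v vV polytope_edgesD(2)[OF e] gap_u_v[OF ij(1), of s]
    gap_u_v[OF ij(2), of s'] by (simp add: ahead_def)

text \<open>After a diagonal edge the next one must be parallel to an axis, with \<open>u\<close> on
  the side away from the corner. Then \<open>ahead_straight\<close> puts \<open>r\<close> within 1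
  of the corner.\<close>

lemma no_diagonal_edge_aux:
  assumes e: "(u, r) \<in> polytope_edges P" and ij: "i \<in> I" "j \<in> I" "i \<noteq> j"
    and r: "gap k s i r = gap k s i u - 1" "gap k s' j r = gap k s' j u - 1"
  shows "gap k s i u + gap k s' j u \<le> 3"
proof (cases "0 < gap k s i r + gap k s' j r")
  case False
  then show ?thesis using r by simp
next
  case True
  have A1: "ahead s i s' j 1 r 0 v" using diagonal_edge_ahead[OF e ij r] .
  note A1' = aheadD[OF A1]
  have uP: "u \<in> P" using uV polytope_verticesD(2) by blast
  obtain w where w: "(r, w) \<in> polytope_edges P"
    "gap k s i w + gap k s' j w < gap k s i r + gap k s' j r"
    using ahead_obtain_edge[OF A1 True] by blast
  note W = ahead_edge[OF A1 w]
  have A2: "ahead s i s' j 2 w 0 v" using W(2) by (simp add: numeral_2_eq_2)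
  note A2' = aheadD[OF A2]
  have off: "u $ l = r $ l" if "l \<noteq> i" "l \<noteq> j" for l
    using ahead_others[OF A1 that] by simp
  define \<alpha> where "\<alpha> = gap k s i w - gap k s i r"
  have wi: "gap k s i w = gap k s i r + \<alpha>" and wj: "gap k s' j w = gap k s' j r + (- 1 - \<alpha>)"
    using W(1) by (auto simp: \<alpha>_def)
  have "\<alpha> \<in> \<int>" using gap_vertex(1)[OF cube] A1'(5) A2'(5) by (simp add: \<alpha>_def)
  moreover have "- 1 \<le> \<alpha>" using reach_u[OF A2'(4,5,1), of s] r wi by simp
  moreover have "\<alpha> \<le> 0" using reach_u[OF A2'(4,5,2), of s'] r wj by simp
  ultimately consider "\<alpha> = - 1" | "\<alpha> = 0" using Ints_abs_le_1_cases[of \<alpha>] by auto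
  then show ?thesis
  proof cases
    case 1
    then show ?thesis
      using ahead_straight[OF ahead_commute[OF A1] w(1) _ _ uP] wi wj r off by simp
  next
    case 2
    then show ?thesis
      using ahead_straight[OF A1 w(1) _ _ uP] wi wj r off by simp
  qed
qed

text \<open>The gaps in \<open>i\<close> and \<open>j\<close> sum to at most 3 at \<open>u\<close>
  and at most 2 at \<open>v\<close>, but to \<open>2 * k\<close> over both vertices; this is at
  least 6.\<close>

lemma no_diagonal_edge:
  assumes e: "(u, r) \<in> polytope_edges P" and ij: "i \<in> I" "j \<in> I" "i \<noteq> j"
    and r: "r $ i \<noteq> u $ i" "r $ j \<noteq> u $ j"
  shows False
proof -
  have rV: "r \<in> polytope_vertices P" using polytope_edgesD(2)[OF e] .
  have nr: "near P (real 1) u r" using near_edge[OF e] by simp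
  \<comment> \<open>Choose the facet towards which the edge moves; the gain is positive, integral
    and at most 1.\<close>
  have *: "\<exists>s. gap k s l r = gap k s l u - 1" if l: "l \<in> I" "r $ l \<noteq> u $ l" for l
  proof -
    have "gap k (u $ l < r $ l) l r < gap k (u $ l < r $ l) l u" using l by (auto simp: gap_def)
    from gap_less_imp[OF rV uV this] reach_u[OF nr rV l(1), of "u $ l < r $ l"]
    show ?thesis by (intro exI[of _ "u $ l < r $ l"]) simp
  qed
  obtain s s' where s: "gap k s i r = gap k s i u - 1" "gap k s' j r = gap k s' j u - 1"
    using * ij r by blast
  \<comment> \<open>With the roles exchanged, \<open>v\<close> has made no step and is already ahead
    thanks to the edge from \<open>u\<close> to \<open>r\<close>.\<close>
  interpret swap: tight k P I v u D B1 B2 B3 by (rule swapped)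
  have "ahead s i s' j 1 r 0 v" using diagonal_edge_ahead[OF e ij s] .
  then have "swap.ahead s i s' j 0 v 1 r" by (auto simp: ahead_def swap.ahead_def)
  then have "gap k s i v + gap k s' j v \<le> 2" by (rule swap.ahead_start_bound)
  moreover have "gap k s i u + gap k s' j u \<le> 3" by (rule no_diagonal_edge_aux[OF e ij s])
  moreover have "gap k s i u + gap k s i v = k" "gap k s' j u + gap k s' j v = k"
    using gap_u_v ij by blast+
  ultimately show False using k3 by linarith
qed

lemma axis_edge:
  assumes i: "i \<in> I" and pos: "0 < gap k s i u"
  obtains r where "(u, r) \<in> polytope_edges P" "gap k s i r = gap k s i u - 1"
    "\<And>l. l \<noteq> i \<Longrightarrow> r $ l = u $ l"
proof -
  obtain r where e: "(u, r) \<in> polytope_edges P" and less: "gap k s i r < gap k s i u"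
    using gap_decreasing_edge[OF i uV pos] by blast
  have rV: "r \<in> polytope_vertices P" using polytope_edgesD(2)[OF e] .
  have nr: "near P (real 1) u r" using near_edge[OF e] by simp
  have "gap k s i r = gap k s i u - 1"
    using gap_less_imp[OF rV uV less] reach_u[OF nr rV i, of s] by simp
  moreover have "r $ i \<noteq> u $ i" using less by (auto simp: gap_def split: if_splits)
  then have "r $ l = u $ l" if "l \<noteq> i" for l
  proof (cases "l \<in> I")
    case True
    then show ?thesis using no_diagonal_edge[OF e i] that \<open>r $ i \<noteq> u $ i\<close> by metis
  next
    case False
    then show ?thesis using outside rV uV polytope_verticesD(2) by blast
  qed
  ultimately show ?thesis using that e by blast
qed

text \<open>Otherwise unit edges in both directions along axis \<open>i\<close> would make
  \<open>u\<close> a midpoint.\<close>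

lemma gap_u_extreme:
  assumes i: "i \<in> I" shows "gap k s i u = 0 \<or> gap k s i u = k"
proof (rule ccontr)
  assume "\<not> ?thesis"
  then have pos: "0 < gap k s i u" "0 < gap k (\<not> s) i u"
    using gap_vertex(2,3)[OF cube uV, of s i] by (auto simp: gap_not)
  obtain r where r: "(u, r) \<in> polytope_edges P" "gap k s i r = gap k s i u - 1"
    "\<And>l. l \<noteq> i \<Longrightarrow> r $ l = u $ l" using axis_edge[OF i pos(1)] by blast
  obtain w where w: "(u, w) \<in> polytope_edges P" "gap k (\<not> s) i w = gap k (\<not> s) i u - 1"
    "\<And>l. l \<noteq> i \<Longrightarrow> w $ l = u $ l" using axis_edge[OF i pos(2)] by blast
  have "r \<in> P" "w \<in> P"
    using polytope_verticesD(2)[OF polytope_edgesD(2)] r(1) w(1) by blast+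
  then have "r = u"
    using r w by (intro vertex_not_between_gaps[OF uV, of r w 1 1 k s i s i]) (auto simp: gap_not)
  then show False using polytope_edgesD(3)[OF r(1)] by simp
qed

lemma no_free_coordinate:
  assumes i: "i \<in> I" shows False
proof -
  have uP: "u \<in> P" using uV polytope_verticesD(2) by blast
  have "gap k True i u = k \<or> gap k False i u = k"
    using gap_u_extreme[OF i, of True] by (auto simp: gap_def)
  then obtain s where s: "gap k s i u = k" by blast
  have vs: "gap k s i v = 0" using gap_u_v[OF i, of s] s by simp
  obtain r where r: "(u, r) \<in> polytope_edges P" "gap k s i r = gap k s i u - 1"
    "\<And>l. l \<noteq> i \<Longrightarrow> r $ l = u $ l" using axis_edge[OF i, of s] s k3 by auto
  have rV: "r \<in> polytope_vertices P" using polytope_edgesD(2)[OF r(1)] .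
  obtain p where p: "(r, p) \<in> polytope_edges P" "gap k s i p < gap k s i r"
    using gap_decreasing_edge[OF i rV, of s] r(2) s k3 by auto
  have pV: "p \<in> polytope_vertices P" using polytope_edgesD(2)[OF p(1)] .
  have pP: "p \<in> P" using pV polytope_verticesD(2) by blast
  have np: "near P (real 2) u p"
    using near_trans[OF near_edge[OF r(1)] near_edge[OF p(1)]] by simp
  have pi: "gap k s i p = real k - 2"
    using gap_less_imp[OF pV rV p(2)] reach_u[OF np pV i, of s] r(2) s by simp
  \<comment> \<open>If only coordinate \<open>i\<close> had changed, \<open>r\<close> would be the
    midpoint of \<open>u\<close> and \<open>p\<close>.\<close>
  have "\<exists>j. j \<noteq> i \<and> p $ j \<noteq> u $ j"
  proof (rule ccontr)
    assume "\<not> ?thesis"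
    then have "u = r"
      using r pi s by (intro vertex_not_between_gaps[OF rV uP pP, of 1 1 k s i s i]) auto
    then show False using polytope_edgesD(3)[OF r(1)] by simp
  qed
  then obtain j where j: "j \<noteq> i" "p $ j \<noteq> u $ j" by blast
  have jI: "j \<in> I" using outside j(2) uP pP by blast
  \<comment> \<open>\<open>s'\<close> selects the facet towards which \<open>p\<close> has moved in
    coordinate \<open>j\<close>. As \<open>u\<close> lies on a facet, its gap there must be
    \<open>k\<close>.\<close>
  define s' where "s' = (u $ j < p $ j)"
  have less: "gap k s' j p < gap k s' j u" using j(2) by (auto simp: gap_def s'_def)
  then have s': "gap k s' j u = k"
    using gap_u_extreme[OF jI, of s'] gap_nonneg[OF cube pP, of s' j] by auto
  have vs': "gap k s' j v = 0" using gap_u_v[OF jI, of s'] s' by simp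
  obtain m where m: "0 \<le> m"
    "2 * real k + m \<le> gap k s i p + gap k s i v + (gap k s' j p + gap k s' j v) + real 2 + real 0 + 1"
    using reach2[OF np pV near_v vV i jI, of s s'] j(1) by metis
  \<comment> \<open>A gain of 3 in two edges is the most that \<open>reach2\<close> permits.\<close>
  then have pj: "gap k s' j p = real k - 1"
    using gap_less_imp[OF pV uV less] pi vs vs' s' by simp
  have A: "ahead s i s' j 2 p 0 v"
    using i jI j(1) np pV near_v vV pi pj vs vs' by (simp add: ahead_def)
  have off1: "u $ l = p $ l" if "l \<noteq> i" "l \<noteq> j" for l
    using ahead_others[OF A that] by simp
  obtain z where z: "z \<in> P" "gap k s i z = 0" "gap k s' j z = 0"
    "\<And>l. l \<noteq> i \<Longrightarrow> l \<noteq> j \<Longrightarrow> z $ l = p $ l" using ahead_corner[OF A] by blast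
  obtain w where w: "(p, w) \<in> polytope_edges P"
    "gap k s i w + gap k s' j w < gap k s i p + gap k s' j p"
    using ahead_obtain_edge[OF A] pi pj k3 by auto
  note W = ahead_edge[OF A w]
  note W' = aheadD[OF W(2)]
  have off: "w $ l = p $ l \<and> u $ l = p $ l \<and> z $ l = p $ l" if "l \<noteq> i" "l \<noteq> j" for l
    using W(3)[OF that] off1[OF that] z(4)[OF that] by simp
  then have off': "w $ l = p $ l \<and> z $ l = p $ l \<and> u $ l = p $ l" if "l \<noteq> i" "l \<noteq> j" for l
    using that by simp
  define \<alpha> where "\<alpha> = gap k s i w - gap k s i p"
  have wi: "gap k s i w = gap k s i p + \<alpha>" and wj: "gap k s' j w = gap k s' j p + (- 1 - \<alpha>)"
    using W(1) by (auto simp: \<alpha>_def)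
  have ui: "gap k s i u = gap k s i p + 2" "gap k s' j u = gap k s' j p + 1"
    and zi: "gap k s i z = gap k s i p + (2 - real k)" "gap k s' j z = gap k s' j p + (1 - real k)"
    using s s' pi pj z by simp_all
  have "\<alpha> \<in> \<int>" using gap_vertex(1)[OF cube] pV W'(5) by (simp add: \<alpha>_def)
  moreover have "- 1 \<le> \<alpha>" using reach_u[OF W'(4,5,1), of s] s wi pi by simp
  moreover have "\<alpha> \<le> 1" using reach_u[OF W'(4,5,2), of s'] s' wj pj by simp
  ultimately consider "\<alpha> = - 1" | "\<alpha> = 0 \<or> \<alpha> = 1" using Ints_abs_le_1_cases by blast
  \<comment> \<open>Relative to \<open>p\<close>, the points \<open>u\<close> and \<open>z\<close>
    are \<open>(2, 1)\<close> and \<open>(2 - k, 1 - k)\<close>. Every possible direction of the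
    edge separates them; for \<open>\<alpha> = - 1\<close> their sides are exchanged.\<close>
  then show False
  proof cases
    case 1
    then show False
      using k3 by (intro edge_side[OF polytope_P w(1) z(1) uP j(1)[symmetric] off' wi wj zi ui]) auto
  next
    case 2
    then show False
      using k3 by (intro edge_side[OF polytope_P w(1) uP z(1) j(1)[symmetric] off wi wj ui zi]) auto
  qed
qed

end


section \<open>Induction on the dimension\<close>

lemma constant_on_eq: "f constant_on S \<Longrightarrow> x \<in> S \<Longrightarrow> y \<in> S \<Longrightarrow> f x = f y"
  unfolding constant_on_def by metis

text \<open>\<open>P\<close> is a point or a segment. The edge from \<open>u\<close> towards
  \<open>v\<close> cannot stop short of \<open>v\<close> or pass beyond it, since \<open>r\<close>
  and \<open>v\<close> are both vertices.\<close>

lemma diam_le_one_coordinate: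
  assumes P: "cube_polytope k P" and outside: "\<And>l x y. l \<noteq> i \<Longrightarrow> x \<in> P \<Longrightarrow> y \<in> P \<Longrightarrow> x $ l = y $ l"
  shows "diam_le P 1"
  unfolding diam_le_def
proof (intro ballI)
  fix u v assume u: "u \<in> polytope_vertices P" and v: "v \<in> polytope_vertices P"
  have uP: "u \<in> P" and vP: "v \<in> P" using u v polytope_verticesD(2) by blast+
  have eqI: "x = y" if "x \<in> P" "y \<in> P" "x $ i = y $ i" for x y
    using outside that unfolding vec_eq_iff by metis
  show "near P 1 u v"
  proof (cases "u = v")
    case True
    then show ?thesis by (simp add: near_refl)
  next
    case False
    then have ne: "u $ i \<noteq> v $ i" using eqI uP vP by blast
    define s where "s = (u $ i < v $ i)"
    have uv: "gap k s i v < gap k s i u" using ne by (auto simp: gap_def s_def)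
    have "polytope P" using P by (simp add: cube_polytope_def)
    then obtain r where r: "(u, r) \<in> polytope_edges P" "gap k s i r < gap k s i u"
      using decreasing_edge[OF _ u affine_fun_gap vP uv] by blast
    have rV: "r \<in> polytope_vertices P" using polytope_edgesD(2)[OF r(1)] .
    have rP: "r \<in> P" using rV polytope_verticesD(2) by blast
    have btw: False if "y \<in> polytope_vertices P" "z \<in> P" "gap k s i z < gap k s i y"
      "gap k s i y < gap k s i u" for y z
    proof -
      have yP: "y \<in> P" using that(1) polytope_verticesD(2) by blast
      have "u = y"
      proof (rule vertex_not_between_gaps[OF that(1) uP that(2)])
        show "0 < gap k s i y - gap k s i z" "0 < gap k s i u - gap k s i y" using that by auto
        show "(gap k s i y - gap k s i z) * (gap k s i y - gap k s i u) =
            (gap k s i u - gap k s i y) * (gap k s i z - gap k s i y)" by (simp add: algebra_simps)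
        then show "(gap k s i y - gap k s i z) * (gap k s i y - gap k s i u) =
            (gap k s i u - gap k s i y) * (gap k s i z - gap k s i y)" .
        show "u $ l = y $ l \<and> z $ l = y $ l" if "l \<noteq> i" for l
          using outside[OF that uP yP] outside[OF that \<open>z \<in> P\<close> yP] by simp
      qed
      with that(4) show False by simp
    qed
    have "gap k s i r = gap k s i v"
      using btw[OF rV vP] btw[OF v rP] r(2) uv
      by (cases "gap k s i r" "gap k s i v" rule: linorder_cases) auto
    then have "r = v" using eqI rP vP by (simp add: gap_eq_iff)
    then show ?thesis using near_edge[OF r(1)] by simp
  qed
qed

definition diam_bound :: "nat \<Rightarrow> nat \<Rightarrow> real" where
  "diam_bound k n = real k * real n - of_int \<lceil>2 * real n / 3\<rceil>"

lemma diam_bound_steps: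
  shows "diam_bound k n + real k - 1 \<le> diam_bound k (n + 1)"
    and "diam_bound k n + 2 * real k - 2 \<le> diam_bound k (n + 2)"
    and "diam_bound k n + 3 * real k - 2 \<le> diam_bound k (n + 3)"
proof -
  define c where "c = \<lceil>2 * real n / 3\<rceil>"
  have c: "2 * real n / 3 \<le> of_int c" unfolding c_def by (rule le_of_int_ceiling)
  \<comment> \<open>The increments 2/3 and 4/3 are rounded up to 1 and 2, while three coordinates
    add exactly 2.\<close>
  have "\<lceil>2 * real (n + 1) / 3\<rceil> \<le> c + 1" "\<lceil>2 * real (n + 2) / 3\<rceil> \<le> c + 2"
    "\<lceil>2 * real (n + 3) / 3\<rceil> \<le> c + 2"
    using c by (auto simp: ceiling_le_iff)
  then have "real_of_int \<lceil>2 * real (n + 1) / 3\<rceil> \<le> of_int c + 1"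
    "real_of_int \<lceil>2 * real (n + 2) / 3\<rceil> \<le> of_int c + 2"
    "real_of_int \<lceil>2 * real (n + 3) / 3\<rceil> \<le> of_int c + 2" by linarith+
  then show "diam_bound k n + real k - 1 \<le> diam_bound k (n + 1)"
    "diam_bound k n + 2 * real k - 2 \<le> diam_bound k (n + 2)"
    "diam_bound k n + 3 * real k - 2 \<le> diam_bound k (n + 3)"
    unfolding diam_bound_def c_def[symmetric] by (simp_all add: algebra_simps)
qed

lemma diam_bound_small:
  "diam_bound k 0 = 0" "diam_bound k 1 = real k - 1" "diam_bound k 2 = 2 * real k - 2"
proof -
  have "\<lceil>2 / 3 :: real\<rceil> = 1" "\<lceil>4 / 3 :: real\<rceil> = 2" by (simp_all add: ceiling_eq_iff)
  then show "diam_bound k 0 = 0" "diam_bound k 1 = real k - 1" "diam_bound k 2 = 2 * real k - 2"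
    by (simp_all add: diam_bound_def)
qed

text \<open>Induction on the number of coordinates that are not constant on \<open>P\<close> keeps all polytopes
  in the same space: passing to a face replaces the projection to a lower dimension.\<close>

lemma diam_le_diam_bound:
  fixes P :: "(real ^ 'd) set"
  assumes k: "3 \<le> k" and P: "cube_polytope k P" and I: "card I = n"
    and outside: "\<And>i x y. i \<notin> I \<Longrightarrow> x \<in> P \<Longrightarrow> y \<in> P \<Longrightarrow> x $ i = y $ i"
  shows "diam_le P (diam_bound k n)"
  using P I outside
proof (induction n arbitrary: P I rule: less_induct)
  case (less n)
  note P = less.prems(1) and outside = less.prems(3)
  have face: "diam_le F (diam_bound k (n - card J))"
    if F: "F face_of P" "F \<noteq> {}" and J: "J \<subseteq> I" "J \<noteq> {}"
      "\<And>i. i \<in> J \<Longrightarrow> (\<lambda>x. x $ i) constant_on F" for F J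
  proof (rule less.IH[of _ F "I - J"])
    have fin: "finite J" "finite I" by auto
    have "0 < card J" "card J \<le> n"
      using J fin less.prems(2) by (auto simp: card_gt_0_iff intro: card_mono)
    then show "n - card J < n" by simp
    show "cube_polytope k F" using cube_polytope_face[OF P F] .
    show "card (I - J) = n - card J" using card_Diff_subset[OF fin(1) J(1)] less.prems(2) by simp
    fix i x y assume i: "i \<notin> I - J" and x: "x \<in> F" and y: "y \<in> F"
    show "x $ i = y $ i"
    proof (cases "i \<in> J")
      case True
      then show ?thesis using constant_on_eq[OF J(3) x y] by blast
    next
      case False
      then show ?thesis using outside[of i x y] i x y face_of_imp_subset[OF F(1)] by blast
    qed
  qed
  \<comment> \<open>The recurrences reach back three coordinates, so smaller \<open>n\<close> are
    treated directly.\<close>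
  consider "n = 0" | "n = 1" | "n = 2" | m where "n = m + 3"
  proof -
    have "n = 0 \<or> n = 1 \<or> n = 2 \<or> n = (n - 3) + 3" by arith
    then show ?thesis using that by blast
  qed
  then show ?case
  proof cases
    case 1
    then have "I = {}" using less.prems(2) by simp
    then have "x = y" if "x \<in> P" "y \<in> P" for x y
      using outside that unfolding vec_eq_iff by blast
    then have "near P 0 u v" if "u \<in> polytope_vertices P" "v \<in> polytope_vertices P" for u v
      using near_refl[of 0 P u] that polytope_verticesD(2) by blast
    then show ?thesis using 1 by (simp add: diam_le_def diam_bound_small)
  next
    case 2
    then obtain i where "I = {i}" using less.prems(2) card_1_singletonE by metis
    then have "diam_le P 1" using diam_le_one_coordinate[OF P, of i] outside by blast
    moreover have "1 \<le> diam_bound k n" using k 2 diam_bound_small(2)[of k] by simp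
    ultimately show ?thesis by (rule diam_le_mono)
  next
    case 3
    then obtain i j where ij: "I = {i, j}" "i \<noteq> j" using less.prems(2) card_2_iff by metis
    have "diam_le F 1" if F: "F face_of P" "F \<noteq> {}" "(\<lambda>x. x $ i) constant_on F" for F
    proof (rule diam_le_one_coordinate[OF cube_polytope_face[OF P F(1,2)]])
      fix l x y assume l: "l \<noteq> j" and x: "x \<in> F" and y: "y \<in> F"
      show "x $ l = y $ l"
      proof (cases "l = i")
        case True
        then show ?thesis using constant_on_eq[OF F(3) x y] by simp
      next
        case False
        then show ?thesis using outside[of l x y] l ij x y face_of_imp_subset[OF F(1)] by blast
      qed
    qed
    \<comment> \<open>A slab of width \<open>k\<close> whose faces of constant \<open>i\<close> have
      diameter at most 1; \<open>k + 1 \<le> 2 * k - 2\<close> holds because \<open>k\<close> is at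
      least 3.\<close>
    then have "diam_le P (real k + 1)" by (rule near_slab[OF P _ gap_le[OF P]])
    moreover have "real k + 1 \<le> diam_bound k n" using k 3 diam_bound_small(3)[of k] by simp
    ultimately show ?thesis by (rule diam_le_mono)
  next
    case (4 m)
    show ?thesis
    proof (rule ccontr)
      assume "\<not> ?thesis"
      then obtain u v where uv: "u \<in> polytope_vertices P" "v \<in> polytope_vertices P"
        "\<not> near P (diam_bound k n) u v" unfolding diam_le_def by blast
      have c: "n - 1 = m + 2" "n - 2 = m + 1" "n - 3 = m" using 4 by auto
      interpret tight k P I u v "diam_bound k n" "diam_bound k (m + 2)" "diam_bound k (m + 1)"
        "diam_bound k m"
      proof
        show "diam_bound k (m + 2) + real k - 1 \<le> diam_bound k n"
          using diam_bound_steps(1)[of k "m + 2"] 4 by (simp add: numeral_3_eq_3)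
        show "diam_bound k (m + 1) + 2 * real k - 2 \<le> diam_bound k n"
          using diam_bound_steps(2)[of k "m + 1"] 4 by (simp add: numeral_3_eq_3)
        show "diam_bound k m + 3 * real k - 2 \<le> diam_bound k n"
          using diam_bound_steps(3)[of k m] 4 by simp
      next
        fix i F assume "i \<in> I" "F face_of P" "F \<noteq> {}" "(\<lambda>x. x $ i) constant_on F"
        then show "diam_le F (diam_bound k (m + 2))" using face[of F "{i}"] c by simp
      next
        fix i j F assume "i \<in> I" "j \<in> I" "i \<noteq> j" "F face_of P" "F \<noteq> {}"
          "(\<lambda>x. x $ i) constant_on F" "(\<lambda>x. x $ j) constant_on F"
        then show "diam_le F (diam_bound k (m + 1))"
          using face[of F "{i, j}"] c by (auto simp: numeral_2_eq_2)
      next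
        fix i j l F assume "i \<in> I" "j \<in> I" "l \<in> I" "i \<noteq> j" "i \<noteq> l" "j \<noteq> l" "F face_of P" "F \<noteq> {}"
          "(\<lambda>x. x $ i) constant_on F" "(\<lambda>x. x $ j) constant_on F" "(\<lambda>x. x $ l) constant_on F"
        then show "diam_le F (diam_bound k m)"
          using face[of F "{i, j, l}"] c by (auto simp: numeral_3_eq_3)
      next
        fix i x y assume "i \<notin> I" "x \<in> P" "y \<in> P"
        then show "x $ i = y $ i" by (rule outside)
      qed (rule P k uv)+
      have "I \<noteq> {}" using less.prems(2) 4 by auto
      then show False using no_free_coordinate by blast
    qed
  qed
qed

lemma lattice_polytope_imp_cube_polytope: "lattice_polytope k P \<Longrightarrow> cube_polytope k P"
  unfolding lattice_polytope_def cube_polytope_def polytope_def by auto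

theorem theorem1p1:
  fixes k :: nat
  assumes "k \<ge> 3"
  shows "max_diameter TYPE('d::finite) k
           \<le> enat (k * CARD('d) - nat \<lceil>2 * real CARD('d) / 3\<rceil>)"
proof -
  have "graph_distance (polytope_edges P) u v
      \<le> enat (k * CARD('d) - nat \<lceil>2 * real CARD('d) / 3\<rceil>)"
    if P: "lattice_polytope k P" and uv: "u \<in> polytope_vertices P" "v \<in> polytope_vertices P"
    for P :: "(real ^ 'd) set" and u v
  proof -
    have "diam_le P (diam_bound k CARD('d))"
      using diam_le_diam_bound[OF assms lattice_polytope_imp_cube_polytope[OF P], of UNIV] by simp
    then obtain m where m: "(u, v) \<in> polytope_edges P ^^ m" "real m \<le> diam_bound k CARD('d)"
      using uv unfolding diam_le_def near_def by blast
    \<comment> \<open>This and the next inequality carry the real bound over to the truncated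
      subtraction of natural numbers.\<close>
    have "0 \<le> \<lceil>2 * real CARD('d) / 3\<rceil>" by simp
    moreover have "real m + of_int \<lceil>2 * real CARD('d) / 3\<rceil> \<le> real (k * CARD('d))"
      using m(2) by (simp add: diam_bound_def)
    ultimately have "m \<le> k * CARD('d) - nat \<lceil>2 * real CARD('d) / 3\<rceil>" by linarith
    moreover have "graph_distance (polytope_edges P) u v \<le> enat m"
      unfolding graph_distance_def using m(1) by (intro INF_lower) simp
    ultimately show ?thesis by (meson enat_ord_simps(1) order_trans)
  qed
  then show ?thesis
    unfolding max_diameter_def polytope_diameter_def by (auto intro!: SUP_least)
qed

end
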